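(* Let $n\ge1$ be an integer and let $\alpha,\beta\in\mathbb R$ with $\alpha\ne-\frac1{2n}$ and $\beta\neq0$. Equip $\Xi_n$ with the (semi-)Riemannian metric $$g_{D,u}((X,x),(Y,y))=\frac12\operatorname{Tr}(D^{-1}XD^{-1}Y)+\alpha\operatorname{Tr}(D^{-1}X)\operatorname{Tr}(D^{-1}Y)+\beta\langle x,Dy\rangle.$$ A smooth curve $\gamma(t)=(D(t),u(t))$ in $\Xi_n$, defined on an open interval $\mathrm{Dom}\,\gamma\subseteq\mathbb R$, is a geodesic (of the Levi-Civita connection of $g$) if and only if for every $t\in\mathrm{Dom}\,\gamma$ $$\ddot D(t)=\dot D(t)D(t)^{-1}\dot D(t)+\beta\,(D(t)\dot u(t))\circ(D(t)\dot u(t))-\frac{2\alpha\beta}{1+2n\alpha}\langle\dot u(t),D(t)\dot u(t)\rangle D(t),$$ $$\ddot u(t)=-D(t)^{-1}\dot D(t)\dot u(t).$$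
   Context: $\Xi_n=\mathcal M_n\times\mathbb R^n$, where $\mathcal M_n$ is the set of real symmetric strictly positive definite $n\times n$ matrices. $\Xi_n$ is regarded as an open subset of the vector space $\mathrm T_n=M_n\times\mathbb R^n$ ($M_n$ = real symmetric $n\times n$ matrices), so the tangent space at each point is $\mathrm T_n$. In the metric, $(D,u)\in\Xi_n$ and $(X,x),(Y,y)\in\mathrm T_n$. For $v,w\in\mathbb R^n$, $v\circ w$ is the $n\times n$ matrix with entries $(v\circ w)_{ij}=v_iw_j$. The metric is Riemannian when $\alpha>-\frac1{2n}$ and $\beta>0$, and otherwise semi-Riemannian. *)

theory Defs
  imports "HOL-Analysis.Analysis"
begin

section \<open>Smooth maps on open sets\<close>

text \<open>For open \<open>U\<close> and finite-dimensional \<open>'a\<close> this is the usual \<open>C\<^sup>k\<close>: all iterated directional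
  derivatives up to order \<open>k\<close> exist and are continuous on \<open>U\<close>.\<close>

primrec Ck_on ::
  "nat \<Rightarrow> 'a::real_normed_vector set \<Rightarrow> ('a \<Rightarrow> 'b::real_normed_vector) \<Rightarrow> bool" where
  "Ck_on 0 U f \<longleftrightarrow> continuous_on U f"
| "Ck_on (Suc k) U f \<longleftrightarrow>
     (\<forall>p\<in>U. f differentiable (at p)) \<and> (\<forall>v. Ck_on k U (\<lambda>p. frechet_derivative f (at p) v))"

definition smooth_on ::
  "'a::real_normed_vector set \<Rightarrow> ('a \<Rightarrow> 'b::real_normed_vector) \<Rightarrow> bool" where
  "smooth_on U f \<longleftrightarrow> (\<forall>k. Ck_on k U f)"

section \<open>Semi-Riemannian geometry of an open subset of a vector space\<close>

text \<open>All tangent spaces of an open \<open>U \<subseteq> 'a\<close> are identified with \<open>'a\<close>.  Vector fields on \<open>U\<close> are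
  functions \<open>'a \<Rightarrow> 'a\<close> and metrics are functions \<open>'a \<Rightarrow> 'a \<Rightarrow> 'a \<Rightarrow> real\<close>, of which only the values at
  points of \<open>U\<close> matter.\<close>

text \<open>The index (signature) is automatically constant on each connected component of \<open>U\<close>, by
  nondegeneracy and continuity.\<close>

definition semi_riemannian_metric_on ::
  "'a::euclidean_space set \<Rightarrow> ('a \<Rightarrow> 'a \<Rightarrow> 'a \<Rightarrow> real) \<Rightarrow> bool" where
  "semi_riemannian_metric_on U g \<longleftrightarrow>
     open U \<and>
     (\<forall>p\<in>U. bilinear (g p)) \<and>
     (\<forall>p\<in>U. \<forall>v w. g p v w = g p w v) \<and>
     (\<forall>p\<in>U. \<forall>v. (\<forall>w. g p v w = 0) \<longrightarrow> v = 0) \<and>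
     (\<forall>v w. smooth_on U (\<lambda>p. g p v w))"

definition deriv_along ::
  "('a \<Rightarrow> 'a) \<Rightarrow> ('a::real_normed_vector \<Rightarrow> 'b::real_normed_vector) \<Rightarrow> 'a \<Rightarrow> 'b" where
  "deriv_along X f = (\<lambda>p. frechet_derivative f (at p) (X p))"

definition lie_bracket :: "('a \<Rightarrow> 'a) \<Rightarrow> ('a \<Rightarrow> 'a) \<Rightarrow> 'a::real_normed_vector \<Rightarrow> 'a" where
  "lie_bracket X Y = (\<lambda>p. deriv_along X Y p - deriv_along Y X p)"

text \<open>\<open>nabla X Y\<close> is the covariant derivative of \<open>Y\<close> along \<open>X\<close>.  Homogeneity in \<open>Y\<close> over the reals is the
  Leibniz rule for constant \<open>f\<close>.\<close>

definition affine_connection_on ::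
  "'a::euclidean_space set \<Rightarrow> (('a \<Rightarrow> 'a) \<Rightarrow> ('a \<Rightarrow> 'a) \<Rightarrow> 'a \<Rightarrow> 'a) \<Rightarrow> bool" where
  "affine_connection_on U nabla \<longleftrightarrow>
     (\<forall>X Y. smooth_on U X \<longrightarrow> smooth_on U Y \<longrightarrow> smooth_on U (nabla X Y)) \<and>
     (\<forall>X X' Y. smooth_on U X \<longrightarrow> smooth_on U X' \<longrightarrow> smooth_on U Y \<longrightarrow>
        (\<forall>p\<in>U. nabla (\<lambda>q. X q + X' q) Y p = nabla X Y p + nabla X' Y p)) \<and>
     (\<forall>(f :: 'a \<Rightarrow> real) X Y. smooth_on U f \<longrightarrow> smooth_on U X \<longrightarrow> smooth_on U Y \<longrightarrow>
        (\<forall>p\<in>U. nabla (\<lambda>q. f q *\<^sub>R X q) Y p = f p *\<^sub>R nabla X Y p)) \<and>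
     (\<forall>X Y Y'. smooth_on U X \<longrightarrow> smooth_on U Y \<longrightarrow> smooth_on U Y' \<longrightarrow>
        (\<forall>p\<in>U. nabla X (\<lambda>q. Y q + Y' q) p = nabla X Y p + nabla X Y' p)) \<and>
     (\<forall>(f :: 'a \<Rightarrow> real) X Y. smooth_on U f \<longrightarrow> smooth_on U X \<longrightarrow> smooth_on U Y \<longrightarrow>
        (\<forall>p\<in>U. nabla X (\<lambda>q. f q *\<^sub>R Y q) p = deriv_along X f p *\<^sub>R Y p + f p *\<^sub>R nabla X Y p))"

definition torsion_free_on ::
  "'a::euclidean_space set \<Rightarrow> (('a \<Rightarrow> 'a) \<Rightarrow> ('a \<Rightarrow> 'a) \<Rightarrow> 'a \<Rightarrow> 'a) \<Rightarrow> bool" where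
  "torsion_free_on U nabla \<longleftrightarrow>
     (\<forall>X Y. smooth_on U X \<longrightarrow> smooth_on U Y \<longrightarrow>
        (\<forall>p\<in>U. nabla X Y p - nabla Y X p = lie_bracket X Y p))"

definition metric_compatible_on ::
  "'a::euclidean_space set \<Rightarrow> ('a \<Rightarrow> 'a \<Rightarrow> 'a \<Rightarrow> real) \<Rightarrow>
   (('a \<Rightarrow> 'a) \<Rightarrow> ('a \<Rightarrow> 'a) \<Rightarrow> 'a \<Rightarrow> 'a) \<Rightarrow> bool" where
  "metric_compatible_on U g nabla \<longleftrightarrow>
     (\<forall>X Y Z. smooth_on U X \<longrightarrow> smooth_on U Y \<longrightarrow> smooth_on U Z \<longrightarrow>
        (\<forall>p\<in>U. deriv_along X (\<lambda>q. g q (Y q) (Z q)) p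
                = g p (nabla X Y p) (Z p) + g p (Y p) (nabla X Z p)))"

definition levi_civita_connection ::
  "'a::euclidean_space set \<Rightarrow> ('a \<Rightarrow> 'a \<Rightarrow> 'a \<Rightarrow> real) \<Rightarrow>
   (('a \<Rightarrow> 'a) \<Rightarrow> ('a \<Rightarrow> 'a) \<Rightarrow> 'a \<Rightarrow> 'a) \<Rightarrow> bool" where
  "levi_civita_connection U g nabla \<longleftrightarrow>
     semi_riemannian_metric_on U g \<and> affine_connection_on U nabla \<and>
     torsion_free_on U nabla \<and> metric_compatible_on U g nabla"

definition velocity :: "(real \<Rightarrow> 'a::real_normed_vector) \<Rightarrow> real \<Rightarrow> 'a" where
  "velocity \<gamma> = (\<lambda>t. vector_derivative \<gamma> (at t))"

text \<open>Covariant derivative of a vector field \<open>V\<close> along a curve \<open>\<gamma>\<close>.  In a frame \<open>e\<^sub>1, \<dots>, e\<^sub>m\<close> of vector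
  fields with \<open>V = \<Sum>k. V\<^sup>k e\<^sub>k\<close> it is \<open>\<Sum>k. (V\<^sup>k)' e\<^sub>k + V\<^sup>k \<nabla>\<^bsub>\<gamma>'\<^esub> e\<^sub>k\<close>.  For the global frame of constant
  vector fields this is the formula below, in which \<open>\<gamma>'(t)\<close> and \<open>V(t)\<close> are extended to constant fields.\<close>

definition covariant_deriv_along ::
  "(('a \<Rightarrow> 'a) \<Rightarrow> ('a \<Rightarrow> 'a) \<Rightarrow> 'a \<Rightarrow> 'a) \<Rightarrow> (real \<Rightarrow> 'a::euclidean_space) \<Rightarrow> (real \<Rightarrow> 'a) \<Rightarrow> real \<Rightarrow> 'a" where
  "covariant_deriv_along nabla \<gamma> V =
     (\<lambda>t. velocity V t + nabla (\<lambda>_. velocity \<gamma> t) (\<lambda>_. V t) (\<gamma> t))"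

text \<open>The values of \<open>nabla X Y\<close> outside \<open>U\<close>, or for non-smooth fields, are irrelevant and unconstrained,
  hence the existential quantifier in place of a unique choice; by the fundamental theorem of
  semi-Riemannian geometry, all witnesses agree where it matters.\<close>

definition geodesic_on ::
  "'a::euclidean_space set \<Rightarrow> ('a \<Rightarrow> 'a \<Rightarrow> 'a \<Rightarrow> real) \<Rightarrow> real set \<Rightarrow> (real \<Rightarrow> 'a) \<Rightarrow> bool" where
  "geodesic_on U g I \<gamma> \<longleftrightarrow>
     smooth_on I \<gamma> \<and> \<gamma> ` I \<subseteq> U \<and>
     (\<exists>nabla. levi_civita_connection U g nabla \<and>
        (\<forall>t\<in>I. covariant_deriv_along nabla \<gamma> (velocity \<gamma>) t = 0))"

section \<open>The space of symmetric matrices\<close>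

typedef 'n::finite sym_mat = "{A :: real^'n^'n. transpose A = A}"
  morphisms mat_of Sym
  by (rule exI[of _ 0]) (simp add: transpose_def vec_eq_iff)

text \<open>The Euclidean structure is the one inherited from \<open>real^'n^'n\<close> (the Frobenius inner product);
  it serves only to provide topology and calculus.\<close>

lemma transpose_mat_of [simp]: "transpose (mat_of A) = mat_of A"
  using mat_of[of A] by simp

instantiation sym_mat :: (finite) real_vector
begin

definition zero_sym_mat :: "'a sym_mat"
  where "zero_sym_mat = Sym 0"
definition plus_sym_mat :: "'a sym_mat \<Rightarrow> 'a sym_mat \<Rightarrow> 'a sym_mat"
  where "plus_sym_mat A B = Sym (mat_of A + mat_of B)"
definition minus_sym_mat :: "'a sym_mat \<Rightarrow> 'a sym_mat \<Rightarrow> 'a sym_mat"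
  where "minus_sym_mat A B = Sym (mat_of A - mat_of B)"
definition uminus_sym_mat :: "'a sym_mat \<Rightarrow> 'a sym_mat"
  where "uminus_sym_mat A = Sym (- mat_of A)"
definition scaleR_sym_mat :: "real \<Rightarrow> 'a sym_mat \<Rightarrow> 'a sym_mat"
  where "scaleR_sym_mat r A = Sym (r *\<^sub>R mat_of A)"

lemma mat_of_sym_mat_simps [simp]:
  "mat_of (0 :: 'a sym_mat) = 0"
  "mat_of (A + B :: 'a sym_mat) = mat_of A + mat_of B"
  "mat_of (A - B :: 'a sym_mat) = mat_of A - mat_of B"
  "mat_of (- A :: 'a sym_mat) = - mat_of A"
  "mat_of (r *\<^sub>R A :: 'a sym_mat) = r *\<^sub>R mat_of A"
proof -
  have sym: "mat_of C $ i $ j = mat_of C $ j $ i" for C :: "'a sym_mat" and i j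
    using transpose_mat_of[of C] by (simp add: transpose_def vec_eq_iff)
  show "mat_of (0 :: 'a sym_mat) = 0"
    "mat_of (A + B :: 'a sym_mat) = mat_of A + mat_of B"
    "mat_of (A - B :: 'a sym_mat) = mat_of A - mat_of B"
    "mat_of (- A :: 'a sym_mat) = - mat_of A"
    "mat_of (r *\<^sub>R A :: 'a sym_mat) = r *\<^sub>R mat_of A"
    unfolding zero_sym_mat_def plus_sym_mat_def minus_sym_mat_def uminus_sym_mat_def
      scaleR_sym_mat_def
    by (subst Sym_inverse, use sym in \<open>auto simp: transpose_def vec_eq_iff\<close>)+
qed

instance
  by standard (simp_all add: mat_of_inject[symmetric] algebra_simps)

end

instantiation sym_mat :: (finite) real_inner
begin

definition inner_sym_mat :: "'a sym_mat \<Rightarrow> 'a sym_mat \<Rightarrow> real"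
  where "inner_sym_mat A B = inner (mat_of A) (mat_of B)"
definition norm_sym_mat :: "'a sym_mat \<Rightarrow> real"
  where "norm_sym_mat A = norm (mat_of A)"
definition dist_sym_mat :: "'a sym_mat \<Rightarrow> 'a sym_mat \<Rightarrow> real"
  where "dist_sym_mat A B = dist (mat_of A) (mat_of B)"
definition sgn_sym_mat :: "'a sym_mat \<Rightarrow> 'a sym_mat"
  where "sgn_sym_mat A = A /\<^sub>R norm A"
definition uniformity_sym_mat :: "('a sym_mat \<times> 'a sym_mat) filter"
  where "uniformity_sym_mat = (INF e\<in>{0<..}. principal {(x, y). dist x y < e})"
definition open_sym_mat :: "'a sym_mat set \<Rightarrow> bool"
  where "open_sym_mat U \<longleftrightarrow> (\<forall>x\<in>U. eventually (\<lambda>(x', y). x' = x \<longrightarrow> y \<in> U) uniformity)"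

instance
proof
  fix A B C :: "'a sym_mat" and r :: real and U :: "'a sym_mat set"
  show "dist A B = norm (A - B)"
    by (simp add: dist_sym_mat_def norm_sym_mat_def dist_norm)
  show "sgn A = A /\<^sub>R norm A"
    by (rule sgn_sym_mat_def)
  show "uniformity = (INF e\<in>{0<..}. principal {(x :: 'a sym_mat, y). dist x y < e})"
    by (rule uniformity_sym_mat_def)
  show "open U \<longleftrightarrow> (\<forall>x\<in>U. \<forall>\<^sub>F (x', y) in uniformity. x' = x \<longrightarrow> y \<in> U)"
    by (rule open_sym_mat_def)
  show "inner A B = inner B A"
    by (simp add: inner_sym_mat_def inner_commute)
  show "inner (A + B) C = inner A C + inner B C"
    by (simp add: inner_sym_mat_def inner_add_left)
  show "inner (r *\<^sub>R A) B = r * inner A B"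
    by (simp add: inner_sym_mat_def)
  show "0 \<le> inner A A"
    by (simp add: inner_sym_mat_def)
  show "inner A A = 0 \<longleftrightarrow> A = 0"
    by (simp add: inner_sym_mat_def mat_of_inject[symmetric])
  show "norm A = sqrt (inner A A)"
    unfolding inner_sym_mat_def norm_sym_mat_def by (rule norm_eq_sqrt_inner)
qed

end

lemma sym_mat_orthonormal_basis_exists:
  "\<exists>B :: 'a::finite sym_mat set. B \<noteq> {} \<and> finite B \<and>
     (\<forall>u\<in>B. \<forall>v\<in>B. inner u v = (if u = v then 1 else 0)) \<and>
     (\<forall>x. (\<forall>u\<in>B. inner x u = 0) \<longleftrightarrow> x = 0)"
proof -
  let ?S = "{A :: real^'a^'a. transpose A = A}"
  have "subspace ?S"
    by (auto simp: subspace_def transpose_def vec_eq_iff)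
  then obtain B where B: "B \<subseteq> ?S" "pairwise orthogonal B" "\<And>x. x \<in> B \<Longrightarrow> norm x = 1"
    "independent B" "span B = ?S"
    by (rule orthonormal_basis_subspace) blast
  let ?B = "{A :: 'a sym_mat. mat_of A \<in> B}"
  have inner_B: "inner u v = (if u = v then 1 else 0)" if "u \<in> ?B" "v \<in> ?B" for u v
  proof (cases "u = v")
    case True
    have "norm (mat_of u) = 1"
      using that B(3) by blast
    with True show ?thesis
      by (simp add: inner_sym_mat_def norm_eq_1)
  next
    case False
    then have "mat_of u \<noteq> mat_of v"
      by (simp add: mat_of_inject)
    with that False show ?thesis
      using pairwiseD[OF B(2), of "mat_of u" "mat_of v"]
      by (simp add: inner_sym_mat_def orthogonal_def)
  qed
  have finite_B: "finite ?B"
  proof -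
    have "finite B"
      using independent_bound[OF B(4)] by blast
    moreover have "inj (mat_of :: 'a sym_mat \<Rightarrow> _)"
      by (simp add: inj_def mat_of_inject)
    ultimately have "finite (mat_of -` B :: 'a sym_mat set)"
      by (rule finite_vimageI)
    then show ?thesis
      by (simp add: vimage_def)
  qed
  have zero: "(\<forall>u\<in>?B. inner x u = 0) \<longleftrightarrow> x = 0" for x
  proof
    assume *: "\<forall>u\<in>?B. inner x u = 0"
    have orth: "orthogonal (mat_of x) b" if "b \<in> B" for b
    proof -
      have b: "mat_of (Sym b) = b"
        using that B(1) by (intro Sym_inverse) blast
      with that * have "inner x (Sym b) = 0"
        by simp
      with b show ?thesis
        by (simp add: inner_sym_mat_def orthogonal_def)
    qed
    have "mat_of x \<in> span B"
      using B(5) mat_of[of x] by simp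
    then have "orthogonal (mat_of x) (mat_of x)"
      using orth by (rule orthogonal_to_span)
    then have "mat_of x = mat_of 0"
      by (simp add: orthogonal_def)
    then show "x = 0"
      by (simp only: mat_of_inject)
  qed simp
  have nonempty: "?B \<noteq> {}"
  proof
    assume "?B = {}"
    then have "Sym (mat 1 :: real^'a^'a) = 0"
      using zero by blast
    then have "mat_of (Sym (mat 1 :: real^'a^'a)) = 0"
      by simp
    then have "(mat 1 :: real^'a^'a) = 0"
      by (subst (asm) Sym_inverse) (auto simp: transpose_mat)
    then have "(mat 1 :: real^'a^'a) $ undefined $ undefined = 0"
      by (simp only: zero_index)
    then show False
      by (simp add: mat_def)
  qed
  show ?thesis
    by (rule exI[of _ ?B], intro conjI ballI allI nonempty finite_B inner_B zero)
qed

instantiation sym_mat :: (finite) euclidean_space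
begin

definition Basis_sym_mat :: "'a sym_mat set" where
  "Basis_sym_mat = (SOME B. B \<noteq> {} \<and> finite B \<and>
     (\<forall>u\<in>B. \<forall>v\<in>B. inner u v = (if u = v then 1 else 0)) \<and>
     (\<forall>x. (\<forall>u\<in>B. inner x u = 0) \<longleftrightarrow> x = 0))"

instance
proof
  have *: "(Basis :: 'a sym_mat set) \<noteq> {} \<and> finite (Basis :: 'a sym_mat set) \<and>
     (\<forall>u\<in>Basis. \<forall>v\<in>Basis. inner (u :: 'a sym_mat) v = (if u = v then 1 else 0)) \<and>
     (\<forall>x :: 'a sym_mat. (\<forall>u\<in>Basis. inner x u = 0) \<longleftrightarrow> x = 0)"
    unfolding Basis_sym_mat_def
    by (rule someI_ex[OF sym_mat_orthonormal_basis_exists])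
  show "(Basis :: 'a sym_mat set) \<noteq> {}"
    by (rule conjunct1[OF *])
  show "finite (Basis :: 'a sym_mat set)"
    by (rule conjunct1[OF conjunct2[OF *]])
  show "inner u v = (if u = v then 1 else 0)" if "u \<in> Basis" "v \<in> Basis" for u v :: "'a sym_mat"
    by (rule bspec[OF bspec[OF conjunct1[OF conjunct2[OF conjunct2[OF *]]] that(1)] that(2)])
  show "(\<forall>u\<in>Basis. inner x u = 0) \<longleftrightarrow> x = 0" for x :: "'a sym_mat"
    by (rule spec[OF conjunct2[OF conjunct2[OF conjunct2[OF *]]]])
qed

end

section \<open>The manifold and its metric\<close>

definition pos_def :: "real^'n::finite^'n \<Rightarrow> bool" where
  "pos_def A \<longleftrightarrow> (\<forall>x. x \<noteq> 0 \<longrightarrow> inner x (A *v x) > 0)"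

definition Xi :: "('n::finite sym_mat \<times> (real^'n)) set" where
  "Xi = {(D, u). pos_def (mat_of D)}"

definition Xi_metric ::
  "real \<Rightarrow> real \<Rightarrow> 'n::finite sym_mat \<times> (real^'n) \<Rightarrow> 'n sym_mat \<times> (real^'n) \<Rightarrow> 'n sym_mat \<times> (real^'n) \<Rightarrow> real"
where
  "Xi_metric \<alpha> \<beta> = (\<lambda>(D, u) (X, x) (Y, y).
     1/2 * trace (matrix_inv (mat_of D) ** mat_of X ** matrix_inv (mat_of D) ** mat_of Y)
     + \<alpha> * trace (matrix_inv (mat_of D) ** mat_of X) * trace (matrix_inv (mat_of D) ** mat_of Y)
     + \<beta> * inner x (mat_of D *v y))"

definition outer_product :: "real^'n \<Rightarrow> real^'n \<Rightarrow> real^'n^'n" where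
  "outer_product v w = (\<chi> i j. v $ i * w $ j)"

end

theory Submission
  imports Defs
begin

text \<open>
  All tangent spaces of \<open>Xi\<close> are the same vector space, so a torsion-free connection is determined by
  its values on constant vector fields, and these form a field \<open>\<Gamma>\<close> of symmetric bilinear maps: the
  connection is \<open>\<nabla>\<^sub>X Y = D Y (X) + \<Gamma>(X, Y)\<close>.  It is compatible with \<open>g\<close> precisely when, for constant
  \<open>v\<close>, \<open>w\<close>, \<open>z\<close>, the derivative of \<open>g(w, z)\<close> in direction \<open>v\<close> is \<open>g(\<Gamma>(v, w), z) + g(w, \<Gamma>(v, z))\<close>.  So
  once a \<open>\<Gamma>\<close> with this property is known, it yields a Levi-Civita connection, every other Levi-Civita
  connection agrees with it on constant fields, and geodesics are the solutions of
  \<open>\<gamma>'' + \<Gamma>(\<gamma>', \<gamma>') = 0\<close>.  This is \<open>geodesic_on_iff_christoffel\<close>, for any metric on an open set.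

  It remains to exhibit \<open>\<Gamma>\<close> for the metric at hand.  Polarising the claimed equations gives, with
  \<open>c = 2 \<alpha> \<beta> / (1 + 2 n \<alpha>)\<close> and \<open>sym\<close> the symmetric part of a matrix,
  \<open>\<Gamma>((X, x), (Y, y)) = (sym (- X D\<^sup>-\<^sup>1 Y - \<beta> (D x) \<circ> (D y)) + c \<langle>x, D y\<rangle> D, D\<^sup>-\<^sup>1 (X y + Y x) / 2)\<close>.
  Writing \<open>X' = D\<^sup>-\<^sup>1 X\<close> and so on, a direct computation (\<open>Xi_metric_christoffel\<close>) evaluates
  \<open>g(\<Gamma>((X, x), (Y, y)), (Z, z))\<close>.  All its terms containing \<open>\<langle>x, D y\<rangle> Tr Z'\<close> add up to a multiple of
  \<open>c / 2 + \<alpha> (n c - \<beta>)\<close>, and \<open>c\<close> is the number for which this vanishes.  In the sum of the values for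
  \<open>((X, x), (Y, y), (Z, z))\<close> and \<open>((X, x), (Z, z), (Y, y))\<close> the remaining vector terms cancel down to
  \<open>\<beta> \<langle>y, X z\<rangle>\<close>, and the matrix terms combine, by cyclicity of the trace, into what the product rule
  and \<open>d(D\<^sup>-\<^sup>1)(X) = - D\<^sup>-\<^sup>1 X D\<^sup>-\<^sup>1\<close> give for the derivative of \<open>g((Y, y), (Z, z))\<close> in direction
  \<open>(X, x)\<close> (\<open>frechet_derivative_Xi_metric\<close>).

  The condition on \<open>\<alpha>\<close> enters twice: in the definition of \<open>c\<close>, and for nondegeneracy of \<open>g\<close>, where
  testing a null vector \<open>(X, x)\<close> against \<open>(D, 0)\<close> gives \<open>(1 + 2 n \<alpha>) Tr X' = 0\<close>.  The analytic input
  is that matrix inversion is smooth (\<open>Ck_on_matrix_inv\<close>): its derivative is a polynomial in the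
  inverse itself, so differentiability can be bootstrapped from continuity.
\<close>

section \<open>Calculus of smooth maps\<close>

text \<open>The derivative at a point of an open set depends only on values inside that set.  Hence
  statements about \<open>Ck_on k U\<close> may freely use identities that hold on \<open>U\<close> alone, such as
  the formula for a derivative.\<close>

lemma Ck_on_cong:
  assumes "open U" "\<And>p. p \<in> U \<Longrightarrow> f p = g p" "Ck_on k U f"
  shows "Ck_on k U g"
  using assms(2,3)
proof (induction k arbitrary: f g)
  case 0
  then show ?case
    using continuous_on_cong[of U U f g] by simp
next
  case (Suc k)
  have "g differentiable at p" if "p \<in> U" for p
  proof -
    have "(f has_derivative frechet_derivative f (at p)) (at p)"
      using Suc.prems(2) that frechet_derivative_works by auto
    then have "(g has_derivative frechet_derivative f (at p)) (at p)"
      by (rule has_derivative_transform_within_open[OF _ assms(1) that Suc.prems(1)])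
    then show ?thesis
      by (rule differentiableI)
  qed
  moreover have "Ck_on k U (\<lambda>p. frechet_derivative g (at p) v)" for v
  proof (rule Suc.IH)
    show "Ck_on k U (\<lambda>p. frechet_derivative f (at p) v)"
      using Suc.prems by simp
    show "frechet_derivative f (at p) v = frechet_derivative g (at p) v" if "p \<in> U" for p
      using frechet_derivative_transform_within_open[of f p U g] Suc.prems that assms(1) by simp
  qed
  ultimately show ?case
    by simp
qed

lemma Ck_on_SucI:
  assumes "open U" "\<And>p. p \<in> U \<Longrightarrow> (f has_derivative f' p) (at p)"
    and "\<And>v. Ck_on k U (\<lambda>p. f' p v)"
  shows "Ck_on (Suc k) U f"
proof -
  have "f' p = frechet_derivative f (at p)" if "p \<in> U" for p
    using assms(2)[OF that] by (rule frechet_derivative_at)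
  then have "Ck_on k U (\<lambda>p. frechet_derivative f (at p) v)" for v
    by (intro Ck_on_cong[OF assms(1) _ assms(3)]) simp
  then show ?thesis
    using assms(2) by (auto simp: differentiable_def)
qed

lemma Ck_on_Suc_has_derivative:
  assumes "Ck_on (Suc k) U f" "p \<in> U"
  shows "(f has_derivative frechet_derivative f (at p)) (at p)"
  using assms frechet_derivative_works by auto

lemma Ck_on_SucD: "Ck_on (Suc k) U f \<Longrightarrow> Ck_on k U f"
proof (induction k arbitrary: f)
  case 0
  then show ?case
    by (auto intro!: continuous_at_imp_continuous_on differentiable_imp_continuous_within)
next
  case (Suc k)
  then show ?case
    by (simp del: Ck_on.simps(2) add: Ck_on.simps(2)[of "Suc k"] Ck_on.simps(2)[of k])
qed

lemma Ck_on_const: "Ck_on k U (\<lambda>p. c)"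
  by (induction k arbitrary: c) simp_all

lemma Ck_on_bounded_linear:
  assumes "bounded_linear L" "open U" "Ck_on k U f"
  shows "Ck_on k U (\<lambda>p. L (f p))"
  using assms(3)
proof (induction k arbitrary: f)
  case 0
  then show ?case
    using bounded_linear.continuous_on[OF assms(1)] by simp
next
  case (Suc k)
  show ?case
  proof (rule Ck_on_SucI[OF assms(2)])
    show "((\<lambda>p. L (f p)) has_derivative (\<lambda>v. L (frechet_derivative f (at p) v))) (at p)" if "p \<in> U" for p
      using bounded_linear.has_derivative[OF assms(1) Ck_on_Suc_has_derivative[OF Suc.prems that]] .
    show "Ck_on k U (\<lambda>p. L (frechet_derivative f (at p) v))" for v
      using Suc by simp
  qed
qed

lemma Ck_on_add:
  assumes "open U" "Ck_on k U f" "Ck_on k U g"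
  shows "Ck_on k U (\<lambda>p. f p + g p)"
  using assms(2,3)
proof (induction k arbitrary: f g)
  case 0
  then show ?case
    by (simp add: continuous_on_add)
next
  case (Suc k)
  show ?case
  proof (rule Ck_on_SucI[OF assms(1)])
    show "((\<lambda>p. f p + g p) has_derivative
        (\<lambda>v. frechet_derivative f (at p) v + frechet_derivative g (at p) v)) (at p)" if "p \<in> U" for p
      using Suc.prems that by (intro has_derivative_add Ck_on_Suc_has_derivative)
    show "Ck_on k U (\<lambda>p. frechet_derivative f (at p) v + frechet_derivative g (at p) v)" for v
      using Suc by simp
  qed
qed

lemma Ck_on_sum:
  assumes "open U" "\<And>i. i \<in> S \<Longrightarrow> Ck_on k U (f i)"
  shows "Ck_on k U (\<lambda>p. \<Sum>i\<in>S. f i p)"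
  using assms(2)
  by (induction S rule: infinite_finite_induct) (auto intro: Ck_on_const Ck_on_add[OF assms(1)])

text \<open>Both terms of the derivative are again \<open>B\<close> applied to two maps, one of them differentiated
  and the other not; lowering the order of the latter by \<open>Ck_on_SucD\<close> makes the induction
  hypothesis apply to both.\<close>

lemma Ck_on_bounded_bilinear:
  assumes "bounded_bilinear B" "open U" "Ck_on k U f" "Ck_on k U g"
  shows "Ck_on k U (\<lambda>p. B (f p) (g p))"
  using assms(3,4)
proof (induction k arbitrary: f g)
  case 0
  then show ?case
    using bounded_bilinear.continuous_on[OF assms(1)] by simp
next
  case (Suc k)
  show ?case
  proof (rule Ck_on_SucI[OF assms(2)])
    show "((\<lambda>p. B (f p) (g p)) has_derivative
        (\<lambda>v. B (f p) (frechet_derivative g (at p) v) + B (frechet_derivative f (at p) v) (g p))) (at p)"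
      if "p \<in> U" for p
      using Suc.prems that
      by (intro bounded_bilinear.FDERIV[OF assms(1)] Ck_on_Suc_has_derivative)
    show "Ck_on k U (\<lambda>p. B (f p) (frechet_derivative g (at p) v)
        + B (frechet_derivative f (at p) v) (g p))" for v
      using Suc Ck_on_SucD[OF Suc.prems(1)] Ck_on_SucD[OF Suc.prems(2)]
      by (intro Ck_on_add[OF assms(2)] Suc.IH) simp_all
  qed
qed

lemma Ck_on_Pair:
  assumes "open U" "Ck_on k U f" "Ck_on k U g"
  shows "Ck_on k U (\<lambda>p. (f p, g p))"
proof -
  have "bounded_linear (\<lambda>x. (x, 0) :: 'b \<times> 'c)" "bounded_linear (\<lambda>x. (0, x) :: 'b \<times> 'c)"
    by (auto intro: bounded_linear_Pair bounded_linear_zero bounded_linear_ident)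
  then have "Ck_on k U (\<lambda>p. (f p, 0) + (0, g p))"
    using assms
    by (intro Ck_on_add Ck_on_bounded_linear[where L = "\<lambda>x. (x, 0)"]
          Ck_on_bounded_linear[where L = "\<lambda>x. (0, x)"])
  then show ?thesis
    by simp
qed

lemma Ck_on_ident: "open U \<Longrightarrow> Ck_on k U (\<lambda>p. p)"
  by (cases k) (auto intro: Ck_on_SucI[where f' = "\<lambda>p v. v"] Ck_on_const)

lemma smooth_on_const: "smooth_on U (\<lambda>p. c)"
  by (simp add: smooth_on_def Ck_on_const)

lemma smooth_on_ident: "open U \<Longrightarrow> smooth_on U (\<lambda>p. p)"
  by (simp add: smooth_on_def Ck_on_ident)

lemma smooth_on_add:
  "open U \<Longrightarrow> smooth_on U f \<Longrightarrow> smooth_on U g \<Longrightarrow> smooth_on U (\<lambda>p. f p + g p)"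
  by (simp add: smooth_on_def Ck_on_add)

lemma smooth_on_Pair:
  "open U \<Longrightarrow> smooth_on U f \<Longrightarrow> smooth_on U g \<Longrightarrow> smooth_on U (\<lambda>p. (f p, g p))"
  by (simp add: smooth_on_def Ck_on_Pair)

lemma smooth_on_bounded_linear:
  "bounded_linear L \<Longrightarrow> open U \<Longrightarrow> smooth_on U f \<Longrightarrow> smooth_on U (\<lambda>p. L (f p))"
  by (simp add: smooth_on_def Ck_on_bounded_linear)

lemma smooth_on_bounded_bilinear:
  "bounded_bilinear B \<Longrightarrow> open U \<Longrightarrow> smooth_on U f \<Longrightarrow> smooth_on U g \<Longrightarrow>
    smooth_on U (\<lambda>p. B (f p) (g p))"
  by (simp add: smooth_on_def Ck_on_bounded_bilinear)

lemma smooth_on_has_derivative: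
  "smooth_on U f \<Longrightarrow> p \<in> U \<Longrightarrow> (f has_derivative frechet_derivative f (at p)) (at p)"
  unfolding smooth_on_def by (meson Ck_on_Suc_has_derivative)

lemma smooth_on_frechet_derivative:
  "smooth_on U f \<Longrightarrow> smooth_on U (\<lambda>p. frechet_derivative f (at p) v)"
  unfolding smooth_on_def by (metis Ck_on.simps(2))

lemma linear_basis_expansion:
  fixes L :: "'b::euclidean_space \<Rightarrow> 'c::real_vector"
  assumes "linear L"
  shows "L y = (\<Sum>b\<in>Basis. inner y b *\<^sub>R L b)"
proof -
  have "L y = L (\<Sum>b\<in>Basis. inner y b *\<^sub>R b)"
    by (simp add: euclidean_representation)
  then show ?thesis
    by (simp add: linear_sum[OF assms] linear_scale[OF assms])
qed

text \<open>A covariant derivative involves linear maps that vary with the point and are applied to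
  an argument that varies too.  Expanding the argument in a basis reduces both smoothness and the
  derivative of such an expression to finite sums of products.\<close>

lemma smooth_on_linear_family:
  fixes L :: "'a::real_normed_vector \<Rightarrow> 'b::euclidean_space \<Rightarrow> 'c::real_normed_vector"
  assumes "open U" "\<And>p. p \<in> U \<Longrightarrow> linear (L p)"
    and "\<And>y. smooth_on U (\<lambda>p. L p y)" "smooth_on U Y"
  shows "smooth_on U (\<lambda>p. L p (Y p))"
  unfolding smooth_on_def
proof
  fix k
  have *: "Ck_on k U (\<lambda>p. L p y)" "Ck_on k U Y" for y
    using assms(3,4) by (auto simp: smooth_on_def)
  have "Ck_on k U (\<lambda>p. \<Sum>b\<in>Basis. inner (Y p) b *\<^sub>R L p b)"
    using assms(1) *
    by (intro Ck_on_sum Ck_on_bounded_bilinear[OF bounded_bilinear_scaleR]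
          Ck_on_bounded_linear[OF bounded_linear_inner_left])
  then show "Ck_on k U (\<lambda>p. L p (Y p))"
    by (rule Ck_on_cong[OF assms(1), rotated])
       (use assms(2) linear_basis_expansion in metis)
qed

lemma smooth_on_bilinear_family:
  fixes G :: "'a::real_normed_vector \<Rightarrow> 'b::euclidean_space \<Rightarrow> 'c::euclidean_space \<Rightarrow> 'd::real_normed_vector"
  assumes "open U" "\<And>p. p \<in> U \<Longrightarrow> bilinear (G p)"
    and "\<And>y z. smooth_on U (\<lambda>p. G p y z)" "smooth_on U Y" "smooth_on U Z"
  shows "smooth_on U (\<lambda>p. G p (Y p) (Z p))"
proof -
  have lin: "linear (\<lambda>y. G p y z)" "linear (G p y)" if "p \<in> U" for p y z
    using assms(2)[OF that] by (auto simp: bilinear_def)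
  have "smooth_on U (\<lambda>p. G p (Y p) z)" for z
    using smooth_on_linear_family[of U "\<lambda>p y. G p y z" Y] assms lin by blast
  then show ?thesis
    using smooth_on_linear_family[of U "\<lambda>p. G p (Y p)" Z] assms lin by blast
qed

text \<open>The product rule for \<open>q \<mapsto> L q (Y q)\<close>.  The hypotheses are stated for \<open>q \<mapsto> L q y\<close> with \<open>y\<close>
  fixed, because this is how the smoothness of a metric is expressed.\<close>

lemma has_derivative_linear_family:
  fixes L :: "'a::real_normed_vector \<Rightarrow> 'b::euclidean_space \<Rightarrow> 'c::real_normed_vector"
  assumes "open U" "p \<in> U" "\<And>q. q \<in> U \<Longrightarrow> linear (L q)"
    and "\<And>y. (\<lambda>q. L q y) differentiable at p" and Y: "(Y has_derivative Y') (at p)"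
  shows "((\<lambda>q. L q (Y q)) has_derivative
           (\<lambda>h. frechet_derivative (\<lambda>q. L q (Y p)) (at p) h + L p (Y' h))) (at p)"
proof -
  let ?D = "\<lambda>y. frechet_derivative (\<lambda>q. L q y) (at p)"
  have L: "((\<lambda>q. L q y) has_derivative ?D y) (at p)" for y
    using assms(4) frechet_derivative_works by blast
  have expand: "((\<lambda>q. L q (Y q)) has_derivative
      (\<lambda>h. (\<Sum>b\<in>Basis. inner (Y p) b *\<^sub>R ?D b h + inner (Y' h) b *\<^sub>R L p b))) (at p)"
    if Y: "(Y has_derivative Y') (at p)" for Y Y'
  proof -
    have "((\<lambda>q. \<Sum>b\<in>Basis. inner (Y q) b *\<^sub>R L q b) has_derivative
      (\<lambda>h. (\<Sum>b\<in>Basis. inner (Y p) b *\<^sub>R ?D b h + inner (Y' h) b *\<^sub>R L p b))) (at p)"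
      by (intro has_derivative_sum has_derivative_scaleR has_derivative_inner_left Y L)
    then show ?thesis
      by (rule has_derivative_transform_within_open[OF _ assms(1,2)])
         (use assms(3) linear_basis_expansion in metis)
  qed
  have "?D (Y p) h = (\<Sum>b\<in>Basis. inner (Y p) b *\<^sub>R ?D b h)" for h
    using fun_cong[OF has_derivative_unique[OF L[of "Y p"] expand[OF has_derivative_const[of "Y p"]]], of h]
    by simp
  moreover have "L p (Y' h) = (\<Sum>b\<in>Basis. inner (Y' h) b *\<^sub>R L p b)" for h
    by (rule linear_basis_expansion[OF assms(3)[OF assms(2)]])
  ultimately show ?thesis
    using expand[OF Y] by (simp add: sum.distrib)
qed

lemma has_derivative_bilinear_family:
  fixes G :: "'a::real_normed_vector \<Rightarrow> 'b::euclidean_space \<Rightarrow> 'c::euclidean_space \<Rightarrow> 'd::real_normed_vector"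
  assumes "open U" "p \<in> U" "\<And>q. q \<in> U \<Longrightarrow> bilinear (G q)"
    and G: "\<And>y z. (\<lambda>q. G q y z) differentiable at p"
    and Y: "(Y has_derivative Y') (at p)" and Z: "(Z has_derivative Z') (at p)"
  shows "((\<lambda>q. G q (Y q) (Z q)) has_derivative
           (\<lambda>h. frechet_derivative (\<lambda>q. G q (Y p) (Z p)) (at p) h
                + G p (Y' h) (Z p) + G p (Y p) (Z' h))) (at p)"
proof -
  have lin: "linear (\<lambda>y. G q y z)" "linear (G q y)" if "q \<in> U" for q y z
    using assms(3)[OF that] by (auto simp: bilinear_def)
  have *: "((\<lambda>q. G q (Y q) z) has_derivative
          (\<lambda>h. frechet_derivative (\<lambda>q. G q (Y p) z) (at p) h + G p (Y' h) z)) (at p)" for z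
    using has_derivative_linear_family[of U p "\<lambda>q y. G q y z" Y Y'] assms(1,2) lin G Y by blast
  have "((\<lambda>q. G q (Y q) (Z q)) has_derivative
      (\<lambda>h. frechet_derivative (\<lambda>q. G q (Y q) (Z p)) (at p) h + G p (Y p) (Z' h))) (at p)"
  proof (rule has_derivative_linear_family[where L = "\<lambda>q. G q (Y q)", OF assms(1,2) _ _ Z])
    show "linear (G q (Y q))" if "q \<in> U" for q
      using lin(2)[OF that] .
    show "(\<lambda>q. G q (Y q) z) differentiable at p" for z
      using * unfolding differentiable_def by blast
  qed
  then show ?thesis
    by (simp add: frechet_derivative_at[OF *, symmetric])
qed

section \<open>The Levi-Civita connection in terms of constant fields\<close>

text \<open>\<open>\<Gamma> p v w\<close> stands for \<open>\<nabla>\<^sub>v w\<close> at \<open>p\<close> with \<open>v\<close> and \<open>w\<close> extended to constant fields, that is, for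
  the Christoffel symbols contracted with \<open>v\<close> and \<open>w\<close>.  The second clause is then torsion-freeness (constant
  fields commute), the last one is metric compatibility.\<close>

definition metric_christoffel_on ::
  "'a::euclidean_space set \<Rightarrow> ('a \<Rightarrow> 'a \<Rightarrow> 'a \<Rightarrow> real) \<Rightarrow> ('a \<Rightarrow> 'a \<Rightarrow> 'a \<Rightarrow> 'a) \<Rightarrow> bool" where
  "metric_christoffel_on U g \<Gamma> \<longleftrightarrow>
     (\<forall>p\<in>U. bilinear (\<Gamma> p)) \<and>
     (\<forall>p\<in>U. \<forall>v w. \<Gamma> p v w = \<Gamma> p w v) \<and>
     (\<forall>v w. smooth_on U (\<lambda>p. \<Gamma> p v w)) \<and>
     (\<forall>p\<in>U. \<forall>v w z. frechet_derivative (\<lambda>q. g q w z) (at p) v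
                      = g p (\<Gamma> p v w) z + g p w (\<Gamma> p v z))"

definition christoffel_connection ::
  "('a \<Rightarrow> 'a \<Rightarrow> 'a \<Rightarrow> 'a) \<Rightarrow> ('a \<Rightarrow> 'a) \<Rightarrow> ('a \<Rightarrow> 'a) \<Rightarrow> 'a::euclidean_space \<Rightarrow> 'a" where
  "christoffel_connection \<Gamma> X Y = (\<lambda>p. deriv_along X Y p + \<Gamma> p (X p) (Y p))"

lemma deriv_along_add:
  assumes "smooth_on U Y" "smooth_on U Y'" "p \<in> U"
  shows "deriv_along X (\<lambda>q. Y q + Y' q) p = deriv_along X Y p + deriv_along X Y' p"
proof -
  have "((\<lambda>q. Y q + Y' q) has_derivative
      (\<lambda>h. frechet_derivative Y (at p) h + frechet_derivative Y' (at p) h)) (at p)"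
    using assms by (intro has_derivative_add smooth_on_has_derivative)
  from frechet_derivative_at[OF this, symmetric] show ?thesis
    by (simp add: deriv_along_def)
qed

lemma deriv_along_scaleR:
  assumes "smooth_on U f" "smooth_on U Y" "p \<in> U"
  shows "deriv_along X (\<lambda>q. f q *\<^sub>R Y q) p = deriv_along X f p *\<^sub>R Y p + f p *\<^sub>R deriv_along X Y p"
proof -
  have "((\<lambda>q. f q *\<^sub>R Y q) has_derivative
      (\<lambda>h. f p *\<^sub>R frechet_derivative Y (at p) h + frechet_derivative f (at p) h *\<^sub>R Y p)) (at p)"
    using assms by (intro has_derivative_scaleR smooth_on_has_derivative)
  from frechet_derivative_at[OF this, symmetric] show ?thesis
    by (simp add: deriv_along_def)
qed

lemma affine_connection_on_christoffel_connection:
  fixes U :: "'a::euclidean_space set"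
  assumes "open U" "\<And>p. p \<in> U \<Longrightarrow> bilinear (\<Gamma> p)" "\<And>v w. smooth_on U (\<lambda>p. \<Gamma> p v w)"
  shows "affine_connection_on U (christoffel_connection \<Gamma>)"
proof -
  have D: "linear (frechet_derivative Y (at p))" if "smooth_on U Y" "p \<in> U" for Y :: "'a \<Rightarrow> 'a" and p
    using has_derivative_linear[OF smooth_on_has_derivative[OF that]] .
  have "smooth_on U (christoffel_connection \<Gamma> X Y)" if XY: "smooth_on U X" "smooth_on U Y" for X Y
  proof -
    have "smooth_on U (deriv_along X Y)"
      unfolding deriv_along_def
      by (rule smooth_on_linear_family) (use assms(1) D XY smooth_on_frechet_derivative in auto)
    moreover have "smooth_on U (\<lambda>p. \<Gamma> p (X p) (Y p))"
      by (rule smooth_on_bilinear_family) (use assms XY in auto)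
    ultimately show ?thesis
      unfolding christoffel_connection_def using assms(1) by (intro smooth_on_add)
  qed
  moreover have "christoffel_connection \<Gamma> (\<lambda>q. X q + X' q) Y p
      = christoffel_connection \<Gamma> X Y p + christoffel_connection \<Gamma> X' Y p"
    if "smooth_on U Y" "p \<in> U" for X X' Y p
    using linear_add[OF D[OF that]] bilinear_ladd[OF assms(2)[OF that(2)]]
    by (simp add: christoffel_connection_def deriv_along_def)
  moreover have "christoffel_connection \<Gamma> (\<lambda>q. f q *\<^sub>R X q) Y p = f p *\<^sub>R christoffel_connection \<Gamma> X Y p"
    if "smooth_on U Y" "p \<in> U" for f X Y p
    using linear_scale[OF D[OF that]] bilinear_lmul[OF assms(2)[OF that(2)]]
    by (simp add: christoffel_connection_def deriv_along_def scaleR_add_right)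
  moreover have "christoffel_connection \<Gamma> X (\<lambda>q. Y q + Y' q) p
      = christoffel_connection \<Gamma> X Y p + christoffel_connection \<Gamma> X Y' p"
    if "smooth_on U Y" "smooth_on U Y'" "p \<in> U" for X Y Y' p
    using deriv_along_add[OF that, of X] bilinear_radd[OF assms(2)[OF that(3)]]
    by (simp add: christoffel_connection_def)
  moreover have "christoffel_connection \<Gamma> X (\<lambda>q. f q *\<^sub>R Y q) p
      = deriv_along X f p *\<^sub>R Y p + f p *\<^sub>R christoffel_connection \<Gamma> X Y p"
    if "smooth_on U f" "smooth_on U Y" "p \<in> U" for f X Y p
    using deriv_along_scaleR[OF that, of X] bilinear_rmul[OF assms(2)[OF that(3)]]
    by (simp add: christoffel_connection_def scaleR_add_right)
  ultimately show ?thesis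
    unfolding affine_connection_on_def by (intro conjI allI impI ballI) assumption+
qed

text \<open>The derivatives of \<open>Y\<close> and \<open>Z\<close> themselves contribute the same terms on both sides, which
  leaves the identity for constant fields.\<close>

lemma metric_compatible_on_christoffel_connection:
  fixes U :: "'a::euclidean_space set"
  assumes g: "semi_riemannian_metric_on U g" and \<Gamma>: "metric_christoffel_on U g \<Gamma>"
  shows "metric_compatible_on U g (christoffel_connection \<Gamma>)"
  unfolding metric_compatible_on_def
proof (intro allI impI ballI)
  fix X Y Z :: "'a \<Rightarrow> 'a" and p
  assume XYZ: "smooth_on U X" "smooth_on U Y" "smooth_on U Z" and p: "p \<in> U"
  have U: "open U" and bil: "\<And>q. q \<in> U \<Longrightarrow> bilinear (g q)" and
    smooth: "\<And>v w. smooth_on U (\<lambda>q. g q v w)"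
    using g by (auto simp: semi_riemannian_metric_on_def)
  have "(\<lambda>q. g q v w) differentiable at p" for v w
    using smooth_on_has_derivative[OF smooth p] by (auto simp: differentiable_def)
  from has_derivative_bilinear_family[OF U p bil this
      smooth_on_has_derivative[OF XYZ(2) p] smooth_on_has_derivative[OF XYZ(3) p]]
  have "((\<lambda>q. g q (Y q) (Z q)) has_derivative
      (\<lambda>h. frechet_derivative (\<lambda>q. g q (Y p) (Z p)) (at p) h
        + g p (frechet_derivative Y (at p) h) (Z p)
        + g p (Y p) (frechet_derivative Z (at p) h))) (at p)" by blast
  from frechet_derivative_at[OF this, symmetric]
  show "deriv_along X (\<lambda>q. g q (Y q) (Z q)) p =
      g p (christoffel_connection \<Gamma> X Y p) (Z p) + g p (Y p) (christoffel_connection \<Gamma> X Z p)"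
    using \<Gamma> p
    by (simp add: deriv_along_def christoffel_connection_def metric_christoffel_on_def
        bilinear_ladd[OF bil] bilinear_radd[OF bil])
qed

lemma levi_civita_christoffel_connection:
  assumes g: "semi_riemannian_metric_on U g" and \<Gamma>: "metric_christoffel_on U g \<Gamma>"
  shows "levi_civita_connection U g (christoffel_connection \<Gamma>)"
proof -
  have "affine_connection_on U (christoffel_connection \<Gamma>)"
    using g \<Gamma> by (intro affine_connection_on_christoffel_connection)
      (auto simp: semi_riemannian_metric_on_def metric_christoffel_on_def)
  moreover have "torsion_free_on U (christoffel_connection \<Gamma>)"
    using \<Gamma> by (auto simp: torsion_free_on_def lie_bracket_def christoffel_connection_def
        metric_christoffel_on_def)
  ultimately show ?thesis
    using g metric_compatible_on_christoffel_connection[OF g \<Gamma>]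
    by (simp add: levi_civita_connection_def)
qed

text \<open>Alternating the two symmetries three times returns the arguments to their places with
  the opposite sign.  Uniqueness of the Levi-Civita connection rests on this: for the
  difference \<open>E\<close> of two such connections, \<open>g(E(v, w), z)\<close> is symmetric in \<open>v\<close>, \<open>w\<close> because both are
  torsion-free and skew in \<open>w\<close>, \<open>z\<close> because both are compatible with \<open>g\<close>.\<close>

lemma symmetric_skew_trilinear_zero:
  fixes T :: "'a \<Rightarrow> 'a \<Rightarrow> 'a \<Rightarrow> real"
  assumes "\<And>v w z. T v w z = T w v z" "\<And>v w z. T v w z = - T v z w"
  shows "T v w z = 0"
proof -
  have "T v w z = - T z v w"
    using assms(2)[of v w z] assms(1)[of v z w] by simp
  also have "\<dots> = T w z v"
    using assms(2)[of z v w] assms(1)[of z w v] by simp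
  also have "\<dots> = - T v w z"
    using assms(2)[of w z v] assms(1)[of w v z] by simp
  finally show ?thesis
    by simp
qed

lemma levi_civita_unique_constant_fields:
  assumes \<Gamma>: "metric_christoffel_on U g \<Gamma>" and N: "levi_civita_connection U g nabla" and p: "p \<in> U"
  shows "nabla (\<lambda>_. v) (\<lambda>_. w) p = \<Gamma> p v w"
proof -
  define E where "E v w = nabla (\<lambda>_. v) (\<lambda>_. w) p - \<Gamma> p v w" for v w
  have bil: "bilinear (g p)" and sym: "\<And>v w. g p v w = g p w v"
    and nondeg: "\<And>v. (\<And>w. g p v w = 0) \<Longrightarrow> v = 0"
    using N p by (auto simp: levi_civita_connection_def semi_riemannian_metric_on_def)
  have E_sym: "E v w = E w v" for v w
  proof -
    have "nabla (\<lambda>_. v) (\<lambda>_. w) p - nabla (\<lambda>_. w) (\<lambda>_. v) p = lie_bracket (\<lambda>_. v) (\<lambda>_. w) p"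
      using N p smooth_on_const[of U v] smooth_on_const[of U w]
      by (simp add: levi_civita_connection_def torsion_free_on_def)
    then show ?thesis
      using \<Gamma> p by (simp add: lie_bracket_def deriv_along_def E_def metric_christoffel_on_def)
  qed
  have E_skew: "g p (E v w) z = - g p (E v z) w" for v w z
  proof -
    have "deriv_along (\<lambda>_. v) (\<lambda>q. g q w z) p
        = g p (nabla (\<lambda>_. v) (\<lambda>_. w) p) z + g p w (nabla (\<lambda>_. v) (\<lambda>_. z) p)"
      using N p smooth_on_const[of U v] smooth_on_const[of U w] smooth_on_const[of U z]
      by (simp add: levi_civita_connection_def metric_compatible_on_def)
    moreover have "deriv_along (\<lambda>_. v) (\<lambda>q. g q w z) p = g p (\<Gamma> p v w) z + g p w (\<Gamma> p v z)"
      using \<Gamma> p by (simp add: deriv_along_def metric_christoffel_on_def)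
    ultimately show ?thesis
      unfolding E_def by (simp add: bilinear_lsub[OF bil] sym[of w])
  qed
  have "g p (E v w) z = 0" for z
    by (rule symmetric_skew_trilinear_zero[of "\<lambda>v w z. g p (E v w) z"])
       (rule arg_cong2[OF E_sym refl, of "g p"], rule E_skew)
  then have "E v w = 0"
    by (rule nondeg)
  then show ?thesis
    by (simp add: E_def)
qed

text \<open>The covariant derivative along a curve evaluates the connection on constant fields only,
  where all Levi-Civita connections agree with \<open>\<Gamma>\<close>; existence of one of them is
  \<open>levi_civita_christoffel_connection\<close>.\<close>

theorem geodesic_on_iff_christoffel:
  assumes g: "semi_riemannian_metric_on U g" and \<Gamma>: "metric_christoffel_on U g \<Gamma>"
    and \<gamma>: "smooth_on I \<gamma>" "\<gamma> ` I \<subseteq> U"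
  shows "geodesic_on U g I \<gamma> \<longleftrightarrow>
    (\<forall>t\<in>I. velocity (velocity \<gamma>) t + \<Gamma> (\<gamma> t) (velocity \<gamma> t) (velocity \<gamma> t) = 0)"
proof -
  have "covariant_deriv_along nabla \<gamma> (velocity \<gamma>) t
      = velocity (velocity \<gamma>) t + \<Gamma> (\<gamma> t) (velocity \<gamma> t) (velocity \<gamma> t)"
    if "levi_civita_connection U g nabla" "t \<in> I" for nabla t
    unfolding covariant_deriv_along_def
    using levi_civita_unique_constant_fields[OF \<Gamma> that(1), of "\<gamma> t"] \<gamma>(2) that(2) by auto
  then show ?thesis
    using \<gamma> levi_civita_christoffel_connection[OF g \<Gamma>] unfolding geodesic_on_def by force
qed

section \<open>Matrices and matrix inversion\<close>

lemma matrix_inv_mult: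
  fixes A :: "real^'n^'n"
  assumes "invertible A"
  shows "matrix_inv A ** A = mat 1" "A ** matrix_inv A = mat 1"
proof -
  have "\<exists>A'. A ** A' = mat 1 \<and> A' ** A = mat 1"
    using assms by (simp add: invertible_def)
  from someI_ex[OF this] show "matrix_inv A ** A = mat 1" "A ** matrix_inv A = mat 1"
    by (simp_all add: matrix_inv_def)
qed

lemma transpose_matrix_inv:
  fixes A :: "real^'n^'n"
  assumes "invertible A" "transpose A = A"
  shows "transpose (matrix_inv A) = matrix_inv A"
proof -
  have "transpose (matrix_inv A) = transpose (matrix_inv A) ** (A ** matrix_inv A)"
    by (simp add: matrix_inv_mult[OF assms(1)])
  also have "\<dots> = transpose (transpose A ** matrix_inv A) ** matrix_inv A"
    by (simp add: matrix_transpose_mul matrix_mul_assoc)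
  also have "\<dots> = matrix_inv A"
    by (simp add: assms(2) matrix_inv_mult[OF assms(1)] transpose_mat)
  finally show ?thesis .
qed

lemma bounded_bilinear_matrix_mult:
  "bounded_bilinear ((**) :: real^'n^'m \<Rightarrow> real^'p^'n \<Rightarrow> real^'p^'m)"
  unfolding bilinear_conv_bounded_bilinear[symmetric] bilinear_def linear_iff
  by (auto simp: vec_eq_iff matrix_matrix_mult_def sum.distrib algebra_simps sum_distrib_left)

lemma bounded_bilinear_matrix_vector_mult:
  "bounded_bilinear ((*v) :: real^'n^'m \<Rightarrow> real^'n \<Rightarrow> real^'m)"
  unfolding bilinear_conv_bounded_bilinear[symmetric] bilinear_def linear_iff
  by (auto simp: vec_eq_iff matrix_vector_mult_def sum.distrib algebra_simps sum_distrib_left)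

lemma bounded_bilinear_outer_product:
  "bounded_bilinear (outer_product :: real^'n \<Rightarrow> real^'n \<Rightarrow> real^'n^'n)"
  unfolding bilinear_conv_bounded_bilinear[symmetric] bilinear_def linear_iff
  by (auto simp: vec_eq_iff outer_product_def algebra_simps)

lemma bounded_linear_trace: "bounded_linear (trace :: real^'n^'n \<Rightarrow> real)"
  unfolding linear_conv_bounded_linear[symmetric] linear_iff
  by (auto simp: trace_def sum.distrib sum_distrib_left)

lemma bounded_linear_mat_of: "bounded_linear (mat_of :: 'n::finite sym_mat \<Rightarrow> real^'n^'n)"
  unfolding linear_conv_bounded_linear[symmetric] linear_iff by simp

text \<open>A linear retraction onto the symmetric matrices.  It turns matrix-valued expressions into
  elements of \<open>sym_mat\<close>, so that smoothness and bilinearity carry over without a proof of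
  symmetry, and it polarises expressions that are symmetric on the diagonal.\<close>

definition sym_part :: "real^'n^'n \<Rightarrow> 'n::finite sym_mat" where
  "sym_part A = Sym ((1/2) *\<^sub>R (A + transpose A))"

lemma mat_of_sym_part: "mat_of (sym_part A) = (1/2) *\<^sub>R (A + transpose A)"
  unfolding sym_part_def
  by (rule Sym_inverse) (simp add: transpose_def vec_eq_iff)

lemma bounded_linear_sym_part: "bounded_linear (sym_part :: real^'n^'n \<Rightarrow> 'n::finite sym_mat)"
  unfolding linear_conv_bounded_linear[symmetric] linear_iff
  by (auto simp: mat_of_inject[symmetric] mat_of_sym_part vec_eq_iff transpose_def algebra_simps)

lemma linear_sym_part: "linear sym_part"
  using bounded_linear_sym_part by (rule bounded_linear.linear)

text \<open>By Cramer's rule the entries of the inverse are quotients of determinants.\<close>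

lemma continuous_on_matrix_inv:
  "continuous_on {A :: real^'n^'n. invertible A} matrix_inv"
proof -
  let ?C = "\<lambda>A :: real^'n^'n. \<chi> k l. det (\<chi> i j. if j = k then axis l 1 $ i else A $ i $ j) / det A"
  have "continuous_on {A. invertible A} (\<lambda>A :: real^'n^'n. if j = k then c else A $ i $ j)"
    for i j k :: 'n and c :: real
    by (cases "j = k") (auto intro!: continuous_intros)
  then have "continuous_on {A. invertible A} ?C"
    unfolding det_def
    by (intro continuous_intros)
       (auto simp: invertible_det_nz det_def intro!: continuous_intros)
  moreover have "matrix_inv A = ?C A" if "invertible A" for A :: "real^'n^'n"
  proof -
    have "matrix_inv A $ k $ l * det A = det (\<chi> i j. if j = k then axis l 1 $ i else A $ i $ j)" for k l
    proof -
      have col: "A *v (matrix_inv A *v axis l 1) = axis l 1"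
        by (simp only: matrix_vector_mul_assoc matrix_inv_mult[OF that] matrix_vector_mul_lid)
      moreover have "(matrix_inv A *v axis l 1) $ k = matrix_inv A $ k $ l"
        by (simp add: matrix_vector_mult_basis column_def)
      ultimately show ?thesis
        using cramer_lemma[of k A "matrix_inv A *v axis l 1"] unfolding col by simp
    qed
    moreover have "det A \<noteq> 0"
      using that by (simp add: invertible_det_nz)
    ultimately show ?thesis
      by (simp add: vec_eq_iff field_simps)
  qed
  ultimately show ?thesis
    using continuous_on_cong[of "{A. invertible A}" "{A. invertible A}" matrix_inv ?C] by simp
qed

lemma open_invertible: "open {A :: real^'n^'n. invertible A}"
proof -
  have "continuous_on UNIV (det :: real^'n^'n \<Rightarrow> real)"
    unfolding det_def by (intro continuous_intros)
  then have "open (det -` (- {0}) :: (real^'n^'n) set)"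
    by (intro open_vimage) auto
  then show ?thesis
    by (simp add: invertible_det_nz vimage_def)
qed

lemmas matrix_mult_simps =
  bounded_bilinear.add_left[OF bounded_bilinear_matrix_mult]
  bounded_bilinear.add_right[OF bounded_bilinear_matrix_mult]
  bounded_bilinear.diff_left[OF bounded_bilinear_matrix_mult]
  bounded_bilinear.diff_right[OF bounded_bilinear_matrix_mult]
  bounded_bilinear.minus_left[OF bounded_bilinear_matrix_mult]
  bounded_bilinear.minus_right[OF bounded_bilinear_matrix_mult]
  bounded_bilinear.scaleR_left[OF bounded_bilinear_matrix_mult]
  bounded_bilinear.scaleR_right[OF bounded_bilinear_matrix_mult]
  bounded_bilinear.zero_left[OF bounded_bilinear_matrix_mult]
  bounded_bilinear.zero_right[OF bounded_bilinear_matrix_mult]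

text \<open>With \<open>C = A\<^sup>-\<^sup>1\<close>, the resolvent identity writes the error of the linear approximation
  as \<open>(C - B\<^sup>-\<^sup>1) (B - A) C\<close>, which is \<open>o(|B - A|)\<close> as soon as inversion is continuous at \<open>A\<close>.\<close>

lemma has_derivative_matrix_inv:
  fixes A :: "real^'n^'n"
  assumes A: "invertible A"
  shows "(matrix_inv has_derivative (\<lambda>H. - (matrix_inv A ** H ** matrix_inv A))) (at A)"
  unfolding has_derivative_at_alt
proof (intro conjI allI impI)
  let ?C = "matrix_inv A"
  show "bounded_linear (\<lambda>H. - (?C ** H ** ?C))"
    by (intro bounded_linear_minus bounded_linear_compose[OF
          bounded_bilinear.bounded_linear_left[OF bounded_bilinear_matrix_mult]
          bounded_bilinear.bounded_linear_right[OF bounded_bilinear_matrix_mult]])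
  fix e :: real assume e: "e > 0"
  obtain K where K: "K > 0" "\<And>(X :: real^'n^'n) (Y :: real^'n^'n). norm (X ** Y) \<le> norm X * norm Y * K"
    using bounded_bilinear.pos_bounded[OF bounded_bilinear_matrix_mult] by blast
  \<comment> \<open>\<open>M\<close> is chosen so that an error below \<open>e / M\<close> in the inverse grows to at most
      \<open>e |B - A|\<close> in a product with \<open>B - A\<close> and \<open>C\<close>, each multiplication costing a factor \<open>K\<close>.  The
      summand 1 keeps the constant positive.\<close>
  define M where "M = (norm ?C + 1) * K * K"
  have M: "M > 0"
    unfolding M_def using K(1) by (intro mult_pos_pos) (simp_all add: add_nonneg_pos)
  have "isCont matrix_inv A"
    using continuous_on_matrix_inv open_invertible A continuous_on_eq_continuous_at by blast
  then obtain d1 where d1: "d1 > 0" "\<And>B. norm (B - A) < d1 \<Longrightarrow> norm (matrix_inv B - ?C) < e / M"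
    using e M unfolding continuous_at_eps_delta dist_norm by (meson divide_pos_pos)
  obtain d2 where d2: "d2 > 0" "\<And>B. norm (B - A) < d2 \<Longrightarrow> invertible B"
    using open_invertible A unfolding open_dist dist_norm by auto
  show "\<exists>d>0. \<forall>B. norm (B - A) < d \<longrightarrow>
      norm (matrix_inv B - ?C - - (?C ** (B - A) ** ?C)) \<le> e * norm (B - A)"
  proof (intro exI conjI allI impI)
    show "min d1 d2 > 0"
      using d1(1) d2(1) by simp
    fix B assume B: "norm (B - A) < min d1 d2"
    have inv: "invertible B"
      using d2(2) B by simp
    have "matrix_inv B ** ((B - A) ** ?C) = ?C - matrix_inv B"
      by (simp add: matrix_mult_simps matrix_mul_assoc matrix_inv_mult[OF inv])
         (simp add: matrix_inv_mult[OF A] flip: matrix_mul_assoc)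
    then have "matrix_inv B - ?C - - (?C ** (B - A) ** ?C) = (?C - matrix_inv B) ** ((B - A) ** ?C)"
      by (simp add: matrix_mult_simps(3) flip: matrix_mul_assoc)
    also have "norm \<dots> \<le> norm (?C - matrix_inv B) * norm ((B - A) ** ?C) * K"
      by (rule K(2))
    also have "\<dots> \<le> (e / M) * (norm (B - A) * norm ?C * K) * K"
      using d1(2)[of B] B K(1) K(2)[of "B - A" ?C] e M
      by (intro mult_right_mono mult_mono) (auto simp: norm_minus_commute less_imp_le)
    also have "\<dots> \<le> (e / M) * (norm (B - A) * (norm ?C + 1) * K) * K"
      using K(1) e M by (intro mult_right_mono mult_left_mono) auto
    also have "\<dots> = (e / M) * M * norm (B - A)"
      by (simp add: M_def)
    also have "\<dots> = e * norm (B - A)"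
      using M by simp
    finally show "norm (matrix_inv B - ?C - - (?C ** (B - A) ** ?C)) \<le> e * norm (B - A)" .
  qed
qed

text \<open>The derivative of \<open>M\<^sup>-\<^sup>1\<close> is \<open>- M\<^sup>-\<^sup>1 M' M\<^sup>-\<^sup>1\<close>, as often differentiable as \<open>M\<^sup>-\<^sup>1\<close> and \<open>M'\<close> are;
  starting from continuity, every induction step gains one order.\<close>

lemma Ck_on_matrix_inv:
  fixes M :: "'a::real_normed_vector \<Rightarrow> real^'n^'n"
  assumes "open U" "\<And>p. p \<in> U \<Longrightarrow> invertible (M p)" "Ck_on k U M"
  shows "Ck_on k U (\<lambda>p. matrix_inv (M p))"
  using assms(3)
proof (induction k)
  case 0
  then show ?case
    using continuous_on_compose2[OF continuous_on_matrix_inv, of U M] assms(2) by auto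
next
  case (Suc k)
  note IH = Suc.IH[OF Ck_on_SucD[OF Suc.prems]]
  show ?case
  proof (rule Ck_on_SucI[OF assms(1)])
    show "((\<lambda>p. matrix_inv (M p)) has_derivative
        (\<lambda>v. - (matrix_inv (M p) ** frechet_derivative M (at p) v ** matrix_inv (M p)))) (at p)"
      if "p \<in> U" for p
      using has_derivative_compose[OF Ck_on_Suc_has_derivative[OF Suc.prems that]
          has_derivative_matrix_inv[OF assms(2)[OF that]]] .
    have "Ck_on k U (\<lambda>p. frechet_derivative M (at p) v)" for v
      using Suc.prems by simp
    then show "Ck_on k U (\<lambda>p. - (matrix_inv (M p) ** frechet_derivative M (at p) v ** matrix_inv (M p)))" for v
      using IH assms(1)
      by (intro Ck_on_bounded_linear[where L = uminus] bounded_linear_minus bounded_linear_ident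
            Ck_on_bounded_bilinear[OF bounded_bilinear_matrix_mult])
  qed
qed

lemma smooth_on_matrix_inv:
  fixes M :: "'a::real_normed_vector \<Rightarrow> real^'n^'n"
  assumes "open U" "\<And>p. p \<in> U \<Longrightarrow> invertible (M p)" "smooth_on U M"
  shows "smooth_on U (\<lambda>p. matrix_inv (M p))"
  using assms by (simp add: smooth_on_def Ck_on_matrix_inv)

lemma pos_def_invertible:
  fixes A :: "real^'n^'n"
  assumes "pos_def A"
  shows "invertible A"
proof -
  have "x = 0" if "A *v x = 0" for x
    using assms that unfolding pos_def_def by force
  then show ?thesis
    unfolding invertible_left_inverse matrix_left_invertible_ker by blast
qed

text \<open>By homogeneity positivity need only be tested on the unit sphere.  The sphere is compact, so the
  matrices failing the test form the projection of a closed set along a compact factor.\<close>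

lemma open_pos_def: "open {A :: real^'n^'n. pos_def A}"
proof -
  let ?T = "{(x, A). inner x (A *v x) \<le> 0} :: ((real^'n) \<times> (real^'n^'n)) set"
  have "closed ?T"
    unfolding split_def
    by (intro closed_Collect_le continuous_intros
          bounded_bilinear.continuous_on[OF bounded_bilinear_matrix_vector_mult])
  then have "closed {A. \<exists>x. x \<in> sphere 0 1 \<and> (x, A) \<in> ?T}"
    by (intro closed_compact_projection) auto
  moreover have "{A :: real^'n^'n. pos_def A} = - {A. \<exists>x. x \<in> sphere 0 1 \<and> (x, A) \<in> ?T}"
  proof -
    have "pos_def A \<longleftrightarrow> (\<forall>x. norm x = 1 \<longrightarrow> inner x (A *v x) > 0)" for A :: "real^'n^'n"
    proof
      assume *: "\<forall>x. norm x = 1 \<longrightarrow> inner x (A *v x) > 0"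
      have "inner x (A *v x) > 0" if "x \<noteq> 0" for x
      proof -
        have "inner (x /\<^sub>R norm x) (A *v (x /\<^sub>R norm x)) > 0"
          using that by (intro *[rule_format]) simp
        then have "inverse (norm x) * (inverse (norm x) * inner x (A *v x)) > 0"
          by (simp only: bounded_bilinear.scaleR_right[OF bounded_bilinear_matrix_vector_mult]
              inner_scaleR_left inner_scaleR_right)
        then show ?thesis
          using that by (simp add: zero_less_mult_iff)
      qed
      then show "pos_def A"
        by (simp add: pos_def_def)
    qed (metis norm_zero pos_def_def zero_neq_one)
    then show ?thesis
      by (auto simp: not_le)
  qed
  ultimately show ?thesis
    by (simp only: open_Compl)
qed

lemmas matrix_vector_mult_simps =
  bounded_bilinear.add_left[OF bounded_bilinear_matrix_vector_mult]
  bounded_bilinear.add_right[OF bounded_bilinear_matrix_vector_mult]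
  bounded_bilinear.scaleR_left[OF bounded_bilinear_matrix_vector_mult]
  bounded_bilinear.scaleR_right[OF bounded_bilinear_matrix_vector_mult]

lemmas outer_product_simps =
  bounded_bilinear.add_left[OF bounded_bilinear_outer_product]
  bounded_bilinear.add_right[OF bounded_bilinear_outer_product]
  bounded_bilinear.scaleR_left[OF bounded_bilinear_outer_product]
  bounded_bilinear.scaleR_right[OF bounded_bilinear_outer_product]

lemmas trace_simps =
  linear_add[OF bounded_linear.linear[OF bounded_linear_trace]]
  linear_diff[OF bounded_linear.linear[OF bounded_linear_trace]]
  linear_neg[OF bounded_linear.linear[OF bounded_linear_trace]]
  linear_scale[OF bounded_linear.linear[OF bounded_linear_trace]]
  linear_0[OF bounded_linear.linear[OF bounded_linear_trace]]

lemma transpose_linear_simps: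
  fixes A B :: "real^'n^'m"
  shows "transpose (A + B) = transpose A + transpose B"
    "transpose (A - B) = transpose A - transpose B"
    "transpose (- A) = - transpose A"
    "transpose (c *\<^sub>R A) = c *\<^sub>R transpose A"
  by (simp_all add: transpose_def vec_eq_iff)

lemma transpose_outer_product: "transpose (outer_product v w) = outer_product w v"
  by (simp add: transpose_def outer_product_def vec_eq_iff mult.commute)

lemma matrix_mult_outer_product: "A ** outer_product v w = outer_product (A *v v) w"
  by (simp add: matrix_matrix_mult_def matrix_vector_mult_def outer_product_def vec_eq_iff
      sum_distrib_right mult.assoc)

lemma outer_product_matrix_mult: "outer_product v w ** A = outer_product v (transpose A *v w)"
  by (simp add: matrix_matrix_mult_def matrix_vector_mult_def outer_product_def vec_eq_iff
      sum_distrib_left transpose_def ac_simps)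

lemma trace_outer_product: "trace (outer_product v w) = inner v w"
  by (simp add: trace_def outer_product_def inner_vec_def)

lemma inner_matrix_vector_mult:
  fixes A :: "real^'n^'m"
  shows "inner x (A *v y) = inner (transpose A *v x) y"
  by (simp add: dot_lmul_matrix[symmetric])

lemma inner_mat_of_commute: "inner x (mat_of A *v y) = inner y (mat_of A *v x)"
  using inner_matrix_vector_mult[of x "mat_of A" y] by (simp add: inner_commute)

text \<open>The trace is the sum of the squares of all entries.\<close>

lemma trace_transpose_mult_self:
  fixes A :: "real^'n^'n"
  shows "trace (transpose A ** A) = 0 \<longleftrightarrow> A = 0"
proof -
  have "trace (transpose A ** A) = (\<Sum>i\<in>UNIV. \<Sum>k\<in>UNIV. (A $ k $ i)\<^sup>2)"
    by (simp add: trace_def matrix_matrix_mult_def transpose_def power2_eq_square)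
  also have "\<dots> = 0 \<longleftrightarrow> A = 0"
    by (auto simp: sum_nonneg_eq_0_iff sum_nonneg vec_eq_iff)
  finally show ?thesis .
qed

section \<open>The metric on the space of positive definite matrices and vectors\<close>

lemma Xi_metric_eq:
  "Xi_metric \<alpha> \<beta> p v w =
     1/2 * trace (matrix_inv (mat_of (fst p)) ** mat_of (fst v) ** matrix_inv (mat_of (fst p)) ** mat_of (fst w))
     + \<alpha> * trace (matrix_inv (mat_of (fst p)) ** mat_of (fst v)) * trace (matrix_inv (mat_of (fst p)) ** mat_of (fst w))
     + \<beta> * inner (snd v) (mat_of (fst p) *v snd w)"
  by (simp add: Xi_metric_def split_def)

lemma open_Xi: "open (Xi :: ('n::finite sym_mat \<times> (real^'n)) set)"
proof -
  have "continuous_on UNIV (\<lambda>p :: 'n sym_mat \<times> (real^'n). mat_of (fst p))"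
    by (intro bounded_linear.continuous_on[OF bounded_linear_mat_of] continuous_intros)
  then have "open ((\<lambda>p :: 'n sym_mat \<times> (real^'n). mat_of (fst p)) -` {A. pos_def A})"
    using open_pos_def by (intro open_vimage)
  moreover have "(\<lambda>p :: 'n sym_mat \<times> (real^'n). mat_of (fst p)) -` {A. pos_def A} = Xi"
    by (auto simp: Xi_def)
  ultimately show ?thesis
    by simp
qed

lemma Xi_invertible: "p \<in> Xi \<Longrightarrow> invertible (mat_of (fst p))"
  using pos_def_invertible by (auto simp: Xi_def)

lemma smooth_on_Xi_mat: "smooth_on Xi (\<lambda>p. mat_of (fst p))"
  by (intro smooth_on_bounded_linear[OF bounded_linear_mat_of]
        smooth_on_bounded_linear[OF bounded_linear_fst] smooth_on_ident open_Xi)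

lemma smooth_on_Xi_inv: "smooth_on Xi (\<lambda>p. matrix_inv (mat_of (fst p)))"
  by (intro smooth_on_matrix_inv open_Xi Xi_invertible smooth_on_Xi_mat)

lemmas smooth_on_intros =
  open_Xi smooth_on_const smooth_on_add smooth_on_Xi_mat smooth_on_Xi_inv smooth_on_ident
  smooth_on_bounded_bilinear[OF bounded_bilinear_matrix_mult]
  smooth_on_bounded_bilinear[OF bounded_bilinear_matrix_vector_mult]
  smooth_on_bounded_bilinear[OF bounded_bilinear_outer_product]
  smooth_on_bounded_bilinear[OF bounded_bilinear_mult]
  smooth_on_bounded_bilinear[OF bounded_bilinear_scaleR]
  smooth_on_bounded_bilinear[OF bounded_bilinear_inner]
  smooth_on_bounded_linear[OF bounded_linear_trace]
  smooth_on_bounded_linear[OF bounded_linear_fst]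

text \<open>The content is nondegeneracy.  Pairing a null vector \<open>(X, x)\<close> with \<open>(D, 0)\<close> shows
  that \<open>Tr (D\<^sup>-\<^sup>1 X) = 0\<close>, by the condition on \<open>\<alpha>\<close>.  Pairing it with \<open>(D\<^sup>-\<^sup>1 X D\<^sup>-\<^sup>1, 0)\<close> then shows that
  the symmetric matrix \<open>D\<^sup>-\<^sup>1 X D\<^sup>-\<^sup>1\<close> has a square of trace zero and therefore vanishes, and pairing
  with \<open>(0, D\<^sup>-\<^sup>1 x)\<close> gives \<open>\<beta> |x|\<^sup>2 = 0\<close>.\<close>

lemma semi_riemannian_metric_on_Xi:
  assumes "\<alpha> \<noteq> - 1 / (2 * real CARD('n))" "\<beta> \<noteq> 0"
  shows "semi_riemannian_metric_on (Xi :: ('n::finite sym_mat \<times> (real^'n)) set) (Xi_metric \<alpha> \<beta>)"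
  unfolding semi_riemannian_metric_on_def
proof (intro conjI ballI allI impI)
  show "open (Xi :: ('n sym_mat \<times> (real^'n)) set)"
    by (rule open_Xi)
  show "bilinear (Xi_metric \<alpha> \<beta> p)" for p :: "'n sym_mat \<times> (real^'n)"
    unfolding bilinear_def linear_iff
    by (auto simp: Xi_metric_eq matrix_mult_simps trace_simps matrix_vector_mult_simps
        inner_add_left inner_add_right algebra_simps)
  show "smooth_on Xi (\<lambda>p. Xi_metric \<alpha> \<beta> p v w)" for v w :: "'n sym_mat \<times> (real^'n)"
    unfolding Xi_metric_eq by (intro smooth_on_intros)
  fix p v :: "'n sym_mat \<times> (real^'n)" assume p: "p \<in> Xi"
  define A P X where "A = mat_of (fst p)" and "P = matrix_inv A" and "X = mat_of (fst v)"
  have inv: "P ** A = mat 1" "A ** P = mat 1"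
    using matrix_inv_mult[OF Xi_invertible[OF p]] by (simp_all add: A_def P_def)
  have tP: "transpose P = P"
    using transpose_matrix_inv[OF Xi_invertible[OF p]] by (simp add: A_def P_def)
  show "Xi_metric \<alpha> \<beta> p v w = Xi_metric \<alpha> \<beta> p w v" for w
  proof -
    have "trace (P ** X ** P ** mat_of (fst w)) = trace (P ** mat_of (fst w) ** P ** X)"
      using trace_mul_sym[of "P ** X" "P ** mat_of (fst w)"] by (simp add: matrix_mul_assoc)
    moreover have "inner (snd v) (A *v snd w) = inner (snd w) (A *v snd v)"
      unfolding A_def by (rule inner_mat_of_commute)
    ultimately show ?thesis
      by (simp add: Xi_metric_eq A_def P_def X_def)
  qed
  assume null: "\<forall>w. Xi_metric \<alpha> \<beta> p v w = 0"
  have null1: "1/2 * trace (P ** X ** P ** mat_of Y) + \<alpha> * trace (P ** X) * trace (P ** mat_of Y) = 0" for Y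
    using null[rule_format, of "(Y, 0)"] by (simp add: Xi_metric_eq A_def P_def X_def)
  have "(1 + 2 * real CARD('n) * \<alpha>) * trace (P ** X) = 0"
    using null1[of "fst p"] inv
    by (simp add: A_def[symmetric] matrix_mul_assoc[symmetric] trace_I field_simps)
  moreover have "1 + 2 * real CARD('n) * \<alpha> \<noteq> 0"
    using assms(1) by (auto simp: field_simps add_eq_0_iff)
  ultimately have tr: "trace (P ** X) = 0"
    by simp
  have "transpose (P ** X ** P) = P ** X ** P"
    by (simp add: matrix_transpose_mul tP X_def matrix_mul_assoc)
  moreover from this have "mat_of (Sym (P ** X ** P)) = P ** X ** P"
    by (intro Sym_inverse) simp
  ultimately have "trace (transpose (P ** X ** P) ** (P ** X ** P)) = 0"
    using null1[of "Sym (P ** X ** P)"] tr by simp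
  then have "P ** X ** P = 0"
    by (simp only: trace_transpose_mult_self)
  then have "A ** (P ** X ** P) ** A = 0"
    by (simp add: matrix_mult_simps)
  then have "X = 0"
    by (simp add: matrix_mul_assoc inv) (simp add: inv flip: matrix_mul_assoc)
  have "Xi_metric \<alpha> \<beta> p v (0, P *v snd v) = 0"
    using null by blast
  then have "snd v = 0"
    using assms(2)
    by (simp add: Xi_metric_eq matrix_mult_simps trace_simps A_def[symmetric] matrix_vector_mul_assoc inv)
  with \<open>X = 0\<close> show "v = 0"
    by (simp add: X_def prod_eq_iff mat_of_inject[symmetric])
qed

text \<open>The polarisation of the quadratic terms in the geodesic equations, with opposite sign.\<close>

definition Xi_christoffel ::
  "real \<Rightarrow> real \<Rightarrow> 'n::finite sym_mat \<times> (real^'n) \<Rightarrow> 'n sym_mat \<times> (real^'n) \<Rightarrow> 'n sym_mat \<times> (real^'n)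
    \<Rightarrow> 'n sym_mat \<times> (real^'n)" where
  "Xi_christoffel \<alpha> \<beta> p v w =
    (sym_part (- (mat_of (fst v) ** matrix_inv (mat_of (fst p)) ** mat_of (fst w))
         + (- \<beta>) *\<^sub>R outer_product (mat_of (fst p) *v snd v) (mat_of (fst p) *v snd w))
      + (2 * \<alpha> * \<beta> / (1 + 2 * real CARD('n) * \<alpha>) * inner (snd v) (mat_of (fst p) *v snd w)) *\<^sub>R fst p,
     (1/2) *\<^sub>R (matrix_inv (mat_of (fst p)) *v (mat_of (fst v) *v snd w + mat_of (fst w) *v snd v)))"

lemma bilinear_Xi_christoffel: "bilinear (Xi_christoffel \<alpha> \<beta> p)"
  unfolding bilinear_def linear_iff
  by (auto simp: Xi_christoffel_def matrix_mult_simps matrix_vector_mult_simps outer_product_simps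
      linear_add[OF linear_sym_part] linear_diff[OF linear_sym_part] linear_scale[OF linear_sym_part] linear_neg[OF linear_sym_part]
      inner_add_left inner_add_right scaleR_add_left scaleR_add_right add_divide_distrib algebra_simps)

lemma Xi_christoffel_commute:
  assumes "p \<in> Xi"
  shows "Xi_christoffel \<alpha> \<beta> p v w = Xi_christoffel \<alpha> \<beta> p w v"
proof -
  let ?A = "mat_of (fst p)"
  have "transpose (matrix_inv ?A) = matrix_inv ?A"
    by (simp add: transpose_matrix_inv Xi_invertible[OF assms])
  moreover have "inner (snd v) (?A *v snd w) = inner (snd w) (?A *v snd v)"
    by (rule inner_mat_of_commute)
  ultimately show ?thesis
    by (simp add: Xi_christoffel_def mat_of_inject[symmetric] mat_of_sym_part transpose_linear_simps
        transpose_outer_product matrix_transpose_mul matrix_mul_assoc add_ac)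
qed

lemma smooth_on_Xi_christoffel:
  "smooth_on (Xi :: ('n::finite sym_mat \<times> (real^'n)) set) (\<lambda>p. Xi_christoffel \<alpha> \<beta> p v w)"
proof -
  have "bounded_linear (uminus :: real^'n^'n \<Rightarrow> real^'n^'n)"
    by (intro bounded_linear_minus bounded_linear_ident)
  note intros = smooth_on_Pair smooth_on_bounded_linear[OF this] smooth_on_intros
    smooth_on_bounded_linear[OF bounded_linear_sym_part]
  show ?thesis
    unfolding Xi_christoffel_def by (intro intros)
qed

lemma frechet_derivative_Xi_metric:
  fixes p :: "'n::finite sym_mat \<times> (real^'n)"
  assumes p: "p \<in> Xi"
  defines "P \<equiv> matrix_inv (mat_of (fst p))"
  shows "frechet_derivative (\<lambda>q. Xi_metric \<alpha> \<beta> q (Y, y) (Z, z)) (at p) (X, x) =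
    - 1/2 * (trace (P ** mat_of X ** P ** mat_of Y ** P ** mat_of Z)
           + trace (P ** mat_of Y ** P ** mat_of X ** P ** mat_of Z))
    - \<alpha> * (trace (P ** mat_of X ** P ** mat_of Y) * trace (P ** mat_of Z)
         + trace (P ** mat_of Y) * trace (P ** mat_of X ** P ** mat_of Z))
    + \<beta> * inner y (mat_of X *v z)"
proof -
  have A: "((\<lambda>q. mat_of (fst q)) has_derivative (\<lambda>h. mat_of (fst h))) (at p)"
    by (intro bounded_linear.has_derivative[OF bounded_linear_mat_of]
        bounded_linear.has_derivative[OF bounded_linear_fst] has_derivative_ident)
  have P: "((\<lambda>q. matrix_inv (mat_of (fst q))) has_derivative (\<lambda>h. - (P ** mat_of (fst h) ** P))) (at p)"
    using has_derivative_compose[OF A has_derivative_matrix_inv[OF Xi_invertible[OF p]]]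
    by (simp add: P_def)
  note mult = bounded_bilinear.FDERIV[OF bounded_bilinear_matrix_mult]
  note trace = bounded_linear.has_derivative[OF bounded_linear_trace]
  note deriv = has_derivative_add has_derivative_mult has_derivative_inner_right
    mult trace A P has_derivative_const bounded_bilinear.FDERIV[OF bounded_bilinear_matrix_vector_mult]
  have "((\<lambda>q. Xi_metric \<alpha> \<beta> q (Y, y) (Z, z)) has_derivative (\<lambda>h.
    - 1/2 * (trace (P ** mat_of (fst h) ** P ** mat_of Y ** P ** mat_of Z)
           + trace (P ** mat_of Y ** P ** mat_of (fst h) ** P ** mat_of Z))
    - \<alpha> * (trace (P ** mat_of (fst h) ** P ** mat_of Y) * trace (P ** mat_of Z)
         + trace (P ** mat_of Y) * trace (P ** mat_of (fst h) ** P ** mat_of Z))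
    + \<beta> * inner y (mat_of (fst h) *v z))) (at p)"
    unfolding Xi_metric_eq fst_conv snd_conv
    apply (rule has_derivative_eq_rhs)
     apply (rule deriv)+
    apply (simp add: P_def[symmetric] fun_eq_iff matrix_mult_simps trace_simps matrix_mul_assoc algebra_simps)
    done
  from frechet_derivative_at[OF this, symmetric] show ?thesis
    by simp
qed

text \<open>With \<open>S\<close> the matrix component of \<open>\<Gamma>((X, x), (Y, y))\<close> and \<open>P = D\<^sup>-\<^sup>1\<close>, the metric sees \<open>S\<close> only
  through \<open>Tr (P S P Z)\<close> and \<open>Tr (P S)\<close>.  Since \<open>P\<close> cancels the factors \<open>D\<close> in the rank-one terms, these
  traces reduce to \<open>\<langle>x, Z y\<rangle>\<close> and \<open>s = \<langle>x, D y\<rangle>\<close>.\<close>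

lemma Xi_metric_christoffel:
  fixes p :: "'n::finite sym_mat \<times> (real^'n)"
  assumes \<alpha>: "\<alpha> \<noteq> - 1 / (2 * real CARD('n))" and p: "p \<in> Xi"
  defines "P \<equiv> matrix_inv (mat_of (fst p))"
  shows "Xi_metric \<alpha> \<beta> p (Xi_christoffel \<alpha> \<beta> p (X, x) (Y, y)) (Z, z) =
    - 1/4 * (trace (P ** mat_of X ** P ** mat_of Y ** P ** mat_of Z)
           + trace (P ** mat_of Y ** P ** mat_of X ** P ** mat_of Z))
    - \<alpha> * trace (P ** mat_of X ** P ** mat_of Y) * trace (P ** mat_of Z)
    + \<beta> / 2 * (inner z (mat_of X *v y) + inner z (mat_of Y *v x) - inner x (mat_of Z *v y))"
proof -
  define A where "A = mat_of (fst p)"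
  define s where "s = inner x (A *v y)"
  define c where "c = 2 * \<alpha> * \<beta> / (1 + 2 * real CARD('n) * \<alpha>)"
  define S where "S = mat_of (fst (Xi_christoffel \<alpha> \<beta> p (X, x) (Y, y)))"
  let ?X = "mat_of X" and ?Y = "mat_of Y" and ?Z = "mat_of Z"
  have inv: "P ** A = mat 1" "A ** P = mat 1"
    using matrix_inv_mult[OF Xi_invertible[OF p]] by (simp_all add: A_def P_def)
  have tP: "transpose P = P"
    using transpose_matrix_inv[OF Xi_invertible[OF p]] by (simp add: P_def)
  have P: "matrix_inv A = P"
    by (simp add: A_def P_def)
  have PA: "P *v (A *v v) = v" and AP: "A *v (P *v v) = v" for v
    by (simp_all only: matrix_vector_mul_assoc inv matrix_vector_mul_lid)
  have tA: "transpose A = A"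
    by (simp add: A_def)
  have s': "inner y (A *v x) = s"
    unfolding s_def A_def by (rule inner_mat_of_commute)
  have S: "S = - (1/2) *\<^sub>R (?X ** P ** ?Y + ?Y ** P ** ?X)
      - (\<beta>/2) *\<^sub>R (outer_product (A *v x) (A *v y) + outer_product (A *v y) (A *v x)) + (c * s) *\<^sub>R A"
    by (simp add: S_def Xi_christoffel_def mat_of_sym_part transpose_linear_simps
        transpose_outer_product matrix_transpose_mul matrix_mul_assoc P tP
        flip: A_def c_def s_def)
       (simp add: algebra_simps)
  have PS: "P ** S = - (1/2) *\<^sub>R (P ** ?X ** P ** ?Y + P ** ?Y ** P ** ?X)
      - (\<beta>/2) *\<^sub>R (outer_product x (A *v y) + outer_product y (A *v x)) + (c * s) *\<^sub>R mat 1"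
    unfolding S
    by (simp only: matrix_mult_simps matrix_mul_assoc matrix_mult_outer_product PA inv)
  have trYX: "trace (P ** ?Y ** P ** ?X) = trace (P ** ?X ** P ** ?Y)"
    using trace_mul_sym[of "P ** ?X" "P ** ?Y"] by (simp add: matrix_mul_assoc)
  have tr1: "trace (P ** S) = - trace (P ** ?X ** P ** ?Y) - \<beta> * s + c * s * real CARD('n)"
    unfolding PS
    by (simp add: trace_simps trace_outer_product trace_I s' trYX flip: s_def)
  have "P ** S ** P ** ?Z = - (1/2) *\<^sub>R (P ** ?X ** P ** ?Y ** P ** ?Z + P ** ?Y ** P ** ?X ** P ** ?Z)
      - (\<beta>/2) *\<^sub>R (outer_product x (?Z *v y) + outer_product y (?Z *v x)) + (c * s) *\<^sub>R (P ** ?Z)"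
    unfolding PS
    by (simp add: matrix_mult_simps outer_product_matrix_mult tP PA)
  moreover have "inner y (?Z *v x) = inner x (?Z *v y)"
    by (rule inner_mat_of_commute)
  ultimately have tr2: "trace (P ** S ** P ** ?Z)
      = - 1/2 * (trace (P ** ?X ** P ** ?Y ** P ** ?Z) + trace (P ** ?Y ** P ** ?X ** P ** ?Z))
        - \<beta> * inner x (?Z *v y) + c * s * trace (P ** ?Z)"
    by (simp add: trace_simps trace_outer_product)
  have vec: "inner (snd (Xi_christoffel \<alpha> \<beta> p (X, x) (Y, y))) (A *v z)
      = 1/2 * (inner z (?X *v y) + inner z (?Y *v x))"
    using inner_matrix_vector_mult[of _ A z]
    by (simp add: Xi_christoffel_def matrix_vector_mult_simps tA AP inner_add_left
        inner_commute[of z] flip: P_def)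
  have "1 + 2 * real CARD('n) * \<alpha> \<noteq> 0"
    using \<alpha> by (auto simp: field_simps add_eq_0_iff)
  \<comment> \<open>This equation determines \<open>c\<close>: it removes the terms with \<open>s * Tr (P Z)\<close>, which do not occur
      in the derivative of the metric.\<close>
  then have c: "c / 2 + \<alpha> * (- \<beta> + c * real CARD('n)) = 0"
    by (simp add: c_def field_simps)
  have "Xi_metric \<alpha> \<beta> p (Xi_christoffel \<alpha> \<beta> p (X, x) (Y, y)) (Z, z)
      = 1/2 * trace (P ** S ** P ** ?Z) + \<alpha> * trace (P ** S) * trace (P ** ?Z)
        + \<beta> * inner (snd (Xi_christoffel \<alpha> \<beta> p (X, x) (Y, y))) (A *v z)"
    by (simp add: Xi_metric_eq S_def A_def P_def)
  also have "\<dots> = - 1/4 * (trace (P ** ?X ** P ** ?Y ** P ** ?Z) + trace (P ** ?Y ** P ** ?X ** P ** ?Z))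
    - \<alpha> * trace (P ** ?X ** P ** ?Y) * trace (P ** ?Z)
    + \<beta> / 2 * (inner z (?X *v y) + inner z (?Y *v x) - inner x (?Z *v y))
    + (c / 2 + \<alpha> * (- \<beta> + c * real CARD('n))) * (s * trace (P ** ?Z))"
    unfolding tr1 tr2 vec by (simp add: algebra_simps)
  finally show ?thesis
    unfolding c by simp
qed

text \<open>Metric compatibility: the two values given by \<open>Xi_metric_christoffel\<close> are brought to a common form
  by the cyclic property of the trace and the symmetry of the matrices.  The products
  of three factors then pair up and add to the halves in the derivative of the metric.\<close>

lemma metric_christoffel_on_Xi:
  fixes \<alpha> \<beta> :: real
  assumes \<alpha>: "\<alpha> \<noteq> - 1 / (2 * real CARD('n))" and \<beta>: "\<beta> \<noteq> 0"
  shows "metric_christoffel_on (Xi :: ('n::finite sym_mat \<times> (real^'n)) set)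
    (Xi_metric \<alpha> \<beta>) (Xi_christoffel \<alpha> \<beta>)"
  unfolding metric_christoffel_on_def
proof (intro conjI ballI allI)
  show "bilinear (Xi_christoffel \<alpha> \<beta> p)" for p :: "'n sym_mat \<times> (real^'n)"
    by (rule bilinear_Xi_christoffel)
  show "smooth_on Xi (\<lambda>p. Xi_christoffel \<alpha> \<beta> p v w)" for v w :: "'n sym_mat \<times> (real^'n)"
    by (rule smooth_on_Xi_christoffel)
  fix p v w :: "'n sym_mat \<times> (real^'n)" assume p: "p \<in> Xi"
  show "Xi_christoffel \<alpha> \<beta> p v w = Xi_christoffel \<alpha> \<beta> p w v"
    using p by (rule Xi_christoffel_commute)
  fix z :: "'n sym_mat \<times> (real^'n)"
  obtain X x Y y Z z' where eqs: "v = (X, x)" "w = (Y, y)" "z = (Z, z')"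
    by (metis surj_pair)
  let ?P = "matrix_inv (mat_of (fst p))" and ?X = "mat_of X" and ?Y = "mat_of Y" and ?Z = "mat_of Z"
  have "Xi_metric \<alpha> \<beta> p w (Xi_christoffel \<alpha> \<beta> p v z) = Xi_metric \<alpha> \<beta> p (Xi_christoffel \<alpha> \<beta> p v z) w"
    using semi_riemannian_metric_on_Xi[OF \<alpha> \<beta>] p unfolding semi_riemannian_metric_on_def by blast
  moreover have "trace (?P ** ?X ** ?P ** ?Z ** ?P ** ?Y) = trace (?P ** ?Y ** ?P ** ?X ** ?P ** ?Z)"
    using trace_mul_sym[of "?P ** ?X ** ?P ** ?Z" "?P ** ?Y"] by (simp add: matrix_mul_assoc)
  moreover have "trace (?P ** ?Z ** ?P ** ?X ** ?P ** ?Y) = trace (?P ** ?X ** ?P ** ?Y ** ?P ** ?Z)"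
    using trace_mul_sym[of "?P ** ?Z" "?P ** ?X ** ?P ** ?Y"] by (simp add: matrix_mul_assoc)
  moreover have "inner z' (?X *v y) = inner y (?X *v z')" "inner z' (?Y *v x) = inner x (?Y *v z')"
    "inner y (?Z *v x) = inner x (?Z *v y)"
    by (rule inner_mat_of_commute)+
  ultimately show "frechet_derivative (\<lambda>q. Xi_metric \<alpha> \<beta> q w z) (at p) v
      = Xi_metric \<alpha> \<beta> p (Xi_christoffel \<alpha> \<beta> p v w) z + Xi_metric \<alpha> \<beta> p w (Xi_christoffel \<alpha> \<beta> p v z)"
    unfolding eqs
    by (simp add: frechet_derivative_Xi_metric[OF p] Xi_metric_christoffel[OF \<alpha> p] algebra_simps)
qed

section \<open>The geodesic equations\<close>

lemma has_vector_derivative_velocity: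
  fixes \<gamma> :: "real \<Rightarrow> 'a::real_normed_vector"
  assumes "smooth_on I \<gamma>" "t \<in> I"
  shows "(\<gamma> has_vector_derivative velocity \<gamma> t) (at t)"
  using differentiableI[OF smooth_on_has_derivative[OF assms]]
  by (simp add: velocity_def vector_derivative_works)

lemma smooth_on_velocity:
  fixes \<gamma> :: "real \<Rightarrow> 'a::real_normed_vector"
  assumes "open I" "smooth_on I \<gamma>"
  shows "smooth_on I (velocity \<gamma>)"
proof -
  have eq: "frechet_derivative \<gamma> (at t) 1 = velocity \<gamma> t" if "t \<in> I" for t
    using frechet_derivative_eq_vector_derivative[OF differentiableI[OF
          smooth_on_has_derivative[OF assms(2) that]]]
    by (simp add: velocity_def)
  have "Ck_on k I (\<lambda>t. frechet_derivative \<gamma> (at t) 1)" for k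
    using smooth_on_frechet_derivative[OF assms(2)] by (simp add: smooth_on_def)
  from Ck_on_cong[OF assms(1) eq this] show ?thesis
    by (simp add: smooth_on_def)
qed

lemma velocity_Pair:
  assumes "smooth_on I a" "smooth_on I b" "t \<in> I"
  shows "velocity (\<lambda>t. (a t, b t)) t = (velocity a t, velocity b t)"
  using has_vector_derivative_Pair[OF has_vector_derivative_velocity[OF assms(1,3)]
      has_vector_derivative_velocity[OF assms(2,3)]]
  by (simp add: velocity_def vector_derivative_at)

text \<open>The first derivatives agree as functions only on \<open>I\<close>; openness of \<open>I\<close> makes this enough for the
  second ones.\<close>

lemma velocity_velocity_Pair:
  assumes "open I" "smooth_on I a" "smooth_on I b" "t \<in> I"
  shows "velocity (velocity (\<lambda>t. (a t, b t))) t
       = (velocity (velocity a) t, velocity (velocity b) t)"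
proof -
  have "velocity (velocity (\<lambda>t. (a t, b t))) t = velocity (\<lambda>t. (velocity a t, velocity b t)) t"
    unfolding velocity_def[of "velocity (\<lambda>t. (a t, b t))"]
      velocity_def[of "\<lambda>t. (velocity a t, velocity b t)"]
  proof (rule vector_derivative_cong_eq)
    show "\<forall>\<^sub>F s in nhds t. s \<in> UNIV \<longrightarrow>
        velocity (\<lambda>t. (a t, b t)) s = (velocity a s, velocity b s)"
      using eventually_nhds_in_open[OF assms(1,4)]
      by eventually_elim (simp add: velocity_Pair[OF assms(2,3)])
  qed simp_all
  also have "\<dots> = (velocity (velocity a) t, velocity (velocity b) t)"
    by (rule velocity_Pair[OF smooth_on_velocity[OF assms(1,2)] smooth_on_velocity[OF assms(1,3)] assms(4)])
  finally show ?thesis .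
qed

lemma geodesic_equation_Xi:
  fixes p :: "'n::finite sym_mat \<times> (real^'n)"
  assumes p: "p \<in> Xi"
  shows "(X', x') + Xi_christoffel \<alpha> \<beta> p (X, x) (X, x) = 0 \<longleftrightarrow>
     mat_of X' = mat_of X ** matrix_inv (mat_of (fst p)) ** mat_of X
         + \<beta> *\<^sub>R outer_product (mat_of (fst p) *v x) (mat_of (fst p) *v x)
         - (2 * \<alpha> * \<beta> / (1 + 2 * real CARD('n) * \<alpha>) * inner x (mat_of (fst p) *v x)) *\<^sub>R mat_of (fst p) \<and>
     x' = - (matrix_inv (mat_of (fst p)) *v (mat_of X *v x))"
proof -
  let ?A = "mat_of (fst p)" and ?c = "2 * \<alpha> * \<beta> / (1 + 2 * real CARD('n) * \<alpha>)"
  let ?T = "mat_of X ** matrix_inv ?A ** mat_of X" and ?O = "outer_product (?A *v x) (?A *v x)"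
  have tP: "transpose (matrix_inv ?A) = matrix_inv ?A"
    by (simp add: transpose_matrix_inv Xi_invertible[OF p])
  have "transpose ?T = ?T" "transpose ?O = ?O"
    by (simp_all add: matrix_transpose_mul matrix_mul_assoc transpose_outer_product tP)
  then have sym: "mat_of (sym_part (- ?T + (- \<beta>) *\<^sub>R ?O)) = - ?T - \<beta> *\<^sub>R ?O"
    by (simp add: mat_of_sym_part transpose_linear_simps flip: scaleR_2)
  have vec: "(1/2) *\<^sub>R (matrix_inv ?A *v (mat_of X *v x + mat_of X *v x)) = matrix_inv ?A *v (mat_of X *v x)"
    by (simp add: matrix_vector_mult_simps flip: scaleR_2)
  have "(X', x') + Xi_christoffel \<alpha> \<beta> p (X, x) (X, x) = 0 \<longleftrightarrow>
      mat_of (X' + (sym_part (- ?T + (- \<beta>) *\<^sub>R ?O) + (?c * inner x (?A *v x)) *\<^sub>R fst p)) = mat_of 0 \<and>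
      x' + matrix_inv ?A *v (mat_of X *v x) = 0"
    \<comment> \<open>Passing to the underlying matrices loses nothing, as \<open>mat_of\<close> is injective.\<close>
    unfolding Xi_christoffel_def fst_conv snd_conv vec
    by (simp only: mat_of_inject) (simp add: zero_prod_def)
  also have "\<dots> \<longleftrightarrow> mat_of X' = ?T + \<beta> *\<^sub>R ?O - (?c * inner x (?A *v x)) *\<^sub>R ?A \<and>
      x' = - (matrix_inv ?A *v (mat_of X *v x))"
    unfolding mat_of_sym_mat_simps sym eq_neg_iff_add_eq_0[of x']
    by (simp add: add_eq_0_iff[of "mat_of X'"] algebra_simps)
  finally show ?thesis .
qed

theorem theorem4p1:
  fixes D :: "real \<Rightarrow> 'n::finite sym_mat" and u :: "real \<Rightarrow> real^'n"
    and I :: "real set" and \<alpha> \<beta> :: real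
  assumes "\<alpha> \<noteq> - 1 / (2 * real CARD('n))" and "\<beta> \<noteq> 0"
    and "open I" and "is_interval I"
    and "smooth_on I (\<lambda>t. (D t, u t))"
    and "\<And>t. t \<in> I \<Longrightarrow> (D t, u t) \<in> Xi"
  shows "geodesic_on Xi (Xi_metric \<alpha> \<beta>) I (\<lambda>t. (D t, u t)) \<longleftrightarrow>
    (\<forall>t\<in>I.
       mat_of (velocity (velocity D) t) =
         mat_of (velocity D t) ** matrix_inv (mat_of (D t)) ** mat_of (velocity D t)
         + \<beta> *\<^sub>R outer_product (mat_of (D t) *v velocity u t) (mat_of (D t) *v velocity u t)
         - (2 * \<alpha> * \<beta> / (1 + 2 * real CARD('n) * \<alpha>)
              * inner (velocity u t) (mat_of (D t) *v velocity u t)) *\<^sub>R mat_of (D t) \<and>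
       velocity (velocity u) t =
         - (matrix_inv (mat_of (D t)) *v (mat_of (velocity D t) *v velocity u t)))"
proof -
  let ?\<gamma> = "\<lambda>t. (D t, u t)"
  have smooth: "smooth_on I D" "smooth_on I u"
    using smooth_on_bounded_linear[OF bounded_linear_fst assms(3,5)]
      smooth_on_bounded_linear[OF bounded_linear_snd assms(3,5)] by simp_all
  have "geodesic_on Xi (Xi_metric \<alpha> \<beta>) I ?\<gamma> \<longleftrightarrow>
      (\<forall>t\<in>I. velocity (velocity ?\<gamma>) t + Xi_christoffel \<alpha> \<beta> (?\<gamma> t) (velocity ?\<gamma> t) (velocity ?\<gamma> t) = 0)"
    using assms(5,6) by (intro geodesic_on_iff_christoffel semi_riemannian_metric_on_Xi
        metric_christoffel_on_Xi assms(1,2)) auto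
  also have "\<dots> \<longleftrightarrow> (\<forall>t\<in>I. (velocity (velocity D) t, velocity (velocity u) t)
      + Xi_christoffel \<alpha> \<beta> (D t, u t) (velocity D t, velocity u t) (velocity D t, velocity u t) = 0)"
    by (intro ball_cong refl)
       (simp add: velocity_Pair[OF smooth] velocity_velocity_Pair[OF assms(3) smooth])
  finally show ?thesis
    using assms(6) by (simp add: geodesic_equation_Xi)
qed

end
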